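(* Let $Y$ be a compact metric space and let $0<\alpha<\frac{2}{3}$. Any continuous map $\varphi\colon Y\to\mathbb{H}$ can be approximated uniformly by $\alpha$-Hölder maps; that is, for every $\epsilon>0$ there is an $\alpha$-Hölder map $\psi\colon Y\to(\mathbb{H},d_c)$ such that $d_c(\varphi(y),\psi(y))\le\epsilon$ for all $y\in Y$.
   Context: The first Heisenberg group is $\mathbb{H}=\mathbb{R}^3$ with multiplication $(x,y,z)\cdot(x',y',z')=(x+x',y+y',z+z'+xy')$. The left-invariant vector fields $X=\partial_x$, $Y=\partial_y+x\partial_z$, $Z=\partial_z$ give the stratification $V_1\oplus V_2=\mathrm{span}\{X,Y\}\oplus\mathrm{span}\{Z\}$ of the Lie algebra. Let $d_R$ be the distance coming from a left-invariant Riemannian metric on $\mathbb{H}$ for which $V_1$ and $V_2$ are orthogonal at the identity. A $d_R$-absolutely continuous curve is horizontal if its derivative lies almost everywhere in the left-invariant subbundle spanned by the vector fields $\partial_x$ and $\partial_y+x\partial_z$. The associated Carnot metric is $d_c(p,q)=\inf\{\ell_R(\gamma):\gamma\text{ a horizontal curve from }p\text{ to }q\}$, where $\ell_R$ is $d_R$-length. The metrics $d_R$ and $d_c$ induce the same topology on $\mathbb{H}$, namely the usual topology of $\mathbb{R}^3$; continuity of $\varphi$ is with respect to this topology. A map $\varphi\colon Z\to W$ of metric spaces is $\alpha$-Hölder if there is $\lambda>0$ with $d_W(\varphi(z),\varphi(z'))\le\lambda d_Z(z,z')^\alpha$ for all $z,z'\in Z$. *)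

theory Defs
  imports "HOL-Analysis.Analysis"
begin

text \<open>
  Distances and lengths are valued in \<^typ>\<open>ennreal\<close>, so that the suprema and infima below are the
  usual extended-real ones (an infimum over no curve is infinite, a non-rectifiable curve has
  infinite length) and no convention for partial operations on the reals enters.
\<close>

type_synonym heis = "real \<times> real \<times> real"

definition heis_mult :: "heis \<Rightarrow> heis \<Rightarrow> heis" (infixl \<open>\<cdot>\<^sub>H\<close> 70) where
  "p \<cdot>\<^sub>H q = (case p of (x, y, z) \<Rightarrow> case q of (x', y', z') \<Rightarrow> (x + x', y + y', z + z' + x * y'))"

definition X_field :: "heis \<Rightarrow> heis" where
  "X_field p = (1, 0, 0)"

definition Y_field :: "heis \<Rightarrow> heis" where
  "Y_field p = (0, 1, fst p)"

definition Z_field :: "heis \<Rightarrow> heis" where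
  "Z_field p = (0, 0, 1)"

definition V1 :: "heis \<Rightarrow> heis set" where
  "V1 p = span {X_field p, Y_field p}"

definition V2 :: "heis \<Rightarrow> heis set" where
  "V2 p = span {Z_field p}"

definition inner_product :: "('v::real_vector \<Rightarrow> 'v \<Rightarrow> real) \<Rightarrow> bool" where
  "inner_product B \<longleftrightarrow> bilinear B \<and> (\<forall>u v. B u v = B v u) \<and> (\<forall>u. u \<noteq> 0 \<longrightarrow> B u u > 0)"

text \<open>
  A metric assigns to every point \<open>p\<close> an inner product \<open>g p\<close> on the tangent space at \<open>p\<close>,
  identified with \<^typ>\<open>heis\<close>. Smoothness of \<open>g\<close> is not required separately: it follows from left
  invariance, since \<open>g\<close> is then determined by \<open>g 0\<close> and the differentials of the (polynomial) left
  translations.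
\<close>

definition left_invariant_riemannian :: "(heis \<Rightarrow> heis \<Rightarrow> heis \<Rightarrow> real) \<Rightarrow> bool" where
  "left_invariant_riemannian g \<longleftrightarrow>
     (\<forall>p. inner_product (g p)) \<and>
     (\<forall>p q u v. g (p \<cdot>\<^sub>H q) (frechet_derivative (\<lambda>r. p \<cdot>\<^sub>H r) (at q) u)
                         (frechet_derivative (\<lambda>r. p \<cdot>\<^sub>H r) (at q) v) = g q u v)"

definition V1_V2_orthogonal :: "(heis \<Rightarrow> heis \<Rightarrow> heis \<Rightarrow> real) \<Rightarrow> bool" where
  "V1_V2_orthogonal g \<longleftrightarrow> (\<forall>u \<in> V1 0. \<forall>v \<in> V2 0. g 0 u v = 0)"

text \<open>
  The integral is a \<^const>\<open>nn_integral\<close> because \<^const>\<open>valid_path\<close> allows the derivative to be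
  unbounded near the finitely many break points; such a path may have infinite length.
\<close>

definition riemannian_length :: "(heis \<Rightarrow> heis \<Rightarrow> heis \<Rightarrow> real) \<Rightarrow> (real \<Rightarrow> heis) \<Rightarrow> ennreal" where
  "riemannian_length g \<gamma> =
     (\<integral>\<^sup>+ t \<in> {0..1}. ennreal (sqrt (g (\<gamma> t) (vector_derivative \<gamma> (at t))
                                              (vector_derivative \<gamma> (at t)))) \<partial>lborel)"

definition d_R :: "(heis \<Rightarrow> heis \<Rightarrow> heis \<Rightarrow> real) \<Rightarrow> heis \<Rightarrow> heis \<Rightarrow> ennreal" where
  "d_R g p q =
     Inf {riemannian_length g \<gamma> | \<gamma>. valid_path \<gamma> \<and> pathstart \<gamma> = p \<and> pathfinish \<gamma> = q}"

text \<open>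
  Curves are parametrised by \<open>[0, 1]\<close>, as in the library's theory of paths; all notions below are
  invariant under affine reparametrisation.
\<close>

definition metric_length :: "('a \<Rightarrow> 'a \<Rightarrow> ennreal) \<Rightarrow> (real \<Rightarrow> 'a) \<Rightarrow> ennreal" where
  "metric_length d \<gamma> =
     Sup {\<Sum>i<n. d (\<gamma> (t i)) (\<gamma> (t (Suc i))) | n t. mono_on {..n} t \<and> t ` {..n} \<subseteq> {0..1}}"

definition abs_continuous_curve :: "('a \<Rightarrow> 'a \<Rightarrow> ennreal) \<Rightarrow> (real \<Rightarrow> 'a) \<Rightarrow> bool" where
  "abs_continuous_curve d \<gamma> \<longleftrightarrow>
     (\<forall>\<epsilon>::real>0. \<exists>\<delta>::real>0. \<forall>(n::nat) a b.
        (\<forall>i<n. 0 \<le> a i \<and> a i \<le> b i \<and> b i \<le> 1) \<and>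
        disjoint_family_on (\<lambda>i. {a i<..<b i}) {..<n} \<and>
        (\<Sum>i<n. b i - a i) < \<delta>
        \<longrightarrow> (\<Sum>i<n. d (\<gamma> (a i)) (\<gamma> (b i))) < ennreal \<epsilon>)"

definition horizontal_curve :: "(heis \<Rightarrow> heis \<Rightarrow> heis \<Rightarrow> real) \<Rightarrow> (real \<Rightarrow> heis) \<Rightarrow> bool" where
  "horizontal_curve g \<gamma> \<longleftrightarrow>
     abs_continuous_curve (d_R g) \<gamma> \<and>
     (AE t in lebesgue_on {0..1}.
        \<exists>v. (\<gamma> has_vector_derivative v) (at t within {0..1}) \<and> v \<in> V1 (\<gamma> t))"

definition d_c :: "(heis \<Rightarrow> heis \<Rightarrow> heis \<Rightarrow> real) \<Rightarrow> heis \<Rightarrow> heis \<Rightarrow> ennreal" where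
  "d_c g p q =
     Inf {metric_length (d_R g) \<gamma> | \<gamma>.
            horizontal_curve g \<gamma> \<and> pathstart \<gamma> = p \<and> pathfinish \<gamma> = q}"

definition holder_on ::
  "real \<Rightarrow> 'a::metric_space set \<Rightarrow> ('b \<Rightarrow> 'b \<Rightarrow> ennreal) \<Rightarrow> ('a \<Rightarrow> 'b) \<Rightarrow> bool" where
  "holder_on \<alpha> S d f \<longleftrightarrow>
     (\<exists>L::real>0. \<forall>z \<in> S. \<forall>z' \<in> S. d (f z) (f z') \<le> ennreal (L * dist z z' powr \<alpha>))"

end

theory Submission
  imports Defs
begin

text \<open>
  The Carnot metric is bounded above by a multiple of the gauge
  \<open>max \<bar>\<Delta>x\<bar> (max \<bar>\<Delta>y\<bar> (sqrt \<bar>\<Delta>z - x * \<Delta>y\<bar>))\<close> (lemma \<open>d_c_le_carnot_gauge\<close>), so it suffices to work with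
  this gauge. By the Stone-Weierstrass theorem a continuous map from a compact space to the group is
  close to one with Lipschitz coordinates. What remains is to find a single map \<open>F\<close> of the group to
  itself, at bounded distance from the identity, that is \<open>\<alpha>\<close>-Hoelder from a Riemannian distance to the
  Carnot metric; conjugating \<open>F\<close> with a dilation makes its distance from the identity small.

  The map \<open>F\<close> is self-similar. Suppose that \<open>\<Phi>\<close> stays at bounded distance from the dilation by \<open>s\<close>
  and stretches small Riemannian distances by at most \<open>L\<close>. Then the maps \<open>dil (1 / s ^ k) \<circ> \<Phi> ^^ k\<close> converge
  uniformly to a map that takes points at Riemannian distance \<open>1 / L ^ k\<close> to points at Carnot distance
  of order \<open>1 / s ^ k\<close>, that is, to a Hoelder map with exponent \<open>ln s / ln L\<close> (lemma
  \<open>rescaled_iterates_limit\<close>). The dilation itself has \<open>L = s\<^sup>2\<close>, because it stretches the vertical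
  direction by \<open>s\<^sup>2\<close>, and so only yields the exponent \<open>1 / 2\<close>.

  To improve \<open>L\<close> to a constant times \<open>s\<close> to the power \<open>3 / 2\<close>, vertical lines are replaced by horizontal
  coils. There is a map at bounded distance from the identity which is Lipschitz for the Riemannian
  distance and maps every vertical line to a horizontal curve (lemma \<open>coil_increment\<close>). Precede and
  follow it by the dilation by \<open>t\<close>, where \<open>s = t\<^sup>2\<close>. Then vertical vectors are stretched by \<open>t\<^sup>2\<close>, made
  horizontal, and stretched by \<open>t\<close>, while horizontal vectors are stretched by \<open>t\<close> and then by at most
  \<open>t\<^sup>2\<close>; altogether by a constant times \<open>t ^ 3\<close> (lemma \<open>riemannian_gauge_stretch\<close>). For large \<open>t\<close> the
  resulting exponent exceeds any given \<open>\<alpha> < 2 / 3\<close>.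

  A coil over a single vertical line can be a helix. The difficulty is to choose the phases of all these
  helices so that they vary in a Lipschitz way along the left-invariant fields, which a single phase
  function cannot do. On the strip \<open>\<bar>x - n\<bar> \<le> 1\<close> the function \<open>z - n * y\<close> is such a phase. So the coil is a
  sum of helices with phases \<open>z - n * y\<close> for even \<open>n\<close> and \<open>2 * (z - n * y)\<close> for odd \<open>n\<close>, cut off by a cosine
  and a sine of \<open>x\<close>. Since neighbouring strips use different frequencies, the areas enclosed by
  the two helices simply add up, and \<open>cos\<^sup>2 + sin\<^sup>2 = 1\<close> makes the total area constant.
\<close>


section \<open>Gauges and dilations\<close>

text \<open>The third coordinate of \<open>p\<^sup>-\<^sup>1 \<cdot> q\<close>, whose first two coordinates are plain differences.\<close>

definition vert :: "heis \<Rightarrow> heis \<Rightarrow> real" where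
  "vert p q = snd (snd q) - snd (snd p) - fst p * (fst (snd q) - fst (snd p))"

text \<open>
  A homogeneous norm of \<open>p\<^sup>-\<^sup>1 \<cdot> q\<close>. Among the equivalent norms the maximum is convenient because it
  satisfies the triangle inequality with constant 1, although it is symmetric only up to a factor.
\<close>

definition carnot_gauge :: "heis \<Rightarrow> heis \<Rightarrow> real" where
  "carnot_gauge p q =
     max \<bar>fst q - fst p\<bar> (max \<bar>fst (snd q) - fst (snd p)\<bar> (sqrt \<bar>vert p q\<bar>))"

lemma carnot_gauge_nonneg: "0 \<le> carnot_gauge p q"
  by (simp add: carnot_gauge_def)

lemma carnot_gauge_le_iff:
  assumes "0 \<le> N"
  shows "carnot_gauge p q \<le> N \<longleftrightarrow>
    \<bar>fst q - fst p\<bar> \<le> N \<and> \<bar>fst (snd q) - fst (snd p)\<bar> \<le> N \<and> \<bar>vert p q\<bar> \<le> N\<^sup>2"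
  using assms by (auto simp: carnot_gauge_def intro: real_le_lsqrt dest: sqrt_le_D)

lemma carnot_gaugeD:
  "\<bar>fst q - fst p\<bar> \<le> carnot_gauge p q" "\<bar>fst (snd q) - fst (snd p)\<bar> \<le> carnot_gauge p q"
  "\<bar>vert p q\<bar> \<le> (carnot_gauge p q)\<^sup>2"
  using carnot_gauge_le_iff[OF carnot_gauge_nonneg, of p q p q] by auto

text \<open>
  Vertical increments are additive up to a term \<open>\<Delta>x * \<Delta>y\<close>, which is at most \<open>M * N\<close> and hence is absorbed by the
  cross term of \<open>(M + N)\<^sup>2\<close>.
\<close>

lemma carnot_gauge_triangle: "carnot_gauge p r \<le> carnot_gauge p q + carnot_gauge q r"
proof -
  define M N where "M = carnot_gauge p q" and "N = carnot_gauge q r"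
  note M = carnot_gaugeD[where p = p and q = q, folded M_def]
    and N = carnot_gaugeD[where p = q and q = r, folded N_def]
  have MN: "0 \<le> M" "0 \<le> N"
    by (simp_all add: M_def N_def carnot_gauge_nonneg)
  have "vert p r = vert p q + vert q r + (fst q - fst p) * (fst (snd r) - fst (snd q))"
    by (simp add: vert_def algebra_simps)
  moreover have "\<bar>(fst q - fst p) * (fst (snd r) - fst (snd q))\<bar> \<le> M * N"
    unfolding abs_mult using M N MN by (intro mult_mono) auto
  ultimately have "\<bar>vert p r\<bar> \<le> M\<^sup>2 + N\<^sup>2 + M * N"
    using M N by linarith
  also have "\<dots> \<le> (M + N)\<^sup>2"
    using MN by (simp add: power2_sum)
  finally show ?thesis
    using M N MN by (subst carnot_gauge_le_iff) (auto simp flip: M_def N_def)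
qed

lemma carnot_gauge_sym: "carnot_gauge q p \<le> 2 * carnot_gauge p q"
proof -
  define N where "N = carnot_gauge p q"
  note N = carnot_gaugeD[where p = p and q = q, folded N_def]
  have N0: "0 \<le> N"
    by (simp add: N_def carnot_gauge_nonneg)
  have "vert q p = (fst q - fst p) * (fst (snd q) - fst (snd p)) - vert p q"
    by (simp add: vert_def algebra_simps)
  moreover have "\<bar>(fst q - fst p) * (fst (snd q) - fst (snd p))\<bar> \<le> N * N"
    unfolding abs_mult using N N0 by (intro mult_mono) auto
  ultimately have "\<bar>vert q p\<bar> \<le> 2 * N\<^sup>2"
    using N by (simp add: power2_eq_square)
  also have "\<dots> \<le> (2 * N)\<^sup>2"
    by (simp add: power_mult_distrib)
  finally show ?thesis
    using N N0 by (subst carnot_gauge_le_iff) (auto simp: abs_minus_commute simp flip: N_def)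
qed

text \<open>
  Comparable to a left-invariant Riemannian distance for nearby points only; at large distances it is
  not a metric. The iteration below compares nearby points only, so no Riemannian distance has to be
  computed.
\<close>

definition riemannian_gauge :: "heis \<Rightarrow> heis \<Rightarrow> real" where
  "riemannian_gauge p q =
     max \<bar>fst q - fst p\<bar> (max \<bar>fst (snd q) - fst (snd p)\<bar> \<bar>vert p q\<bar>)"

lemma riemannian_gauge_nonneg: "0 \<le> riemannian_gauge p q"
  by (simp add: riemannian_gauge_def)

lemma carnot_gauge_le_1:
  assumes "riemannian_gauge p q \<le> 1"
  shows "carnot_gauge p q \<le> 1"
  using assms by (auto simp: riemannian_gauge_def carnot_gauge_le_iff)

lemma carnot_gauge_le_riemannian_gauge: "carnot_gauge p q \<le> 1 + riemannian_gauge p q"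
proof -
  define \<rho> where "\<rho> = riemannian_gauge p q"
  have \<rho>: "\<bar>fst q - fst p\<bar> \<le> \<rho>" "\<bar>fst (snd q) - fst (snd p)\<bar> \<le> \<rho>" "\<bar>vert p q\<bar> \<le> \<rho>" "0 \<le> \<rho>"
    by (auto simp: \<rho>_def riemannian_gauge_def)
  have "\<rho> \<le> (1 + \<rho>)\<^sup>2"
    using \<rho>(4) mult_nonneg_nonneg[OF \<rho>(4) \<rho>(4)] by (simp add: power2_eq_square algebra_simps)
  with \<rho>(3) have "\<bar>vert p q\<bar> \<le> (1 + \<rho>)\<^sup>2"
    by linarith
  then show ?thesis
    using \<rho> by (subst carnot_gauge_le_iff) (auto simp flip: \<rho>_def)
qed

definition dil :: "real \<Rightarrow> heis \<Rightarrow> heis" where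
  "dil r = (\<lambda>(x, y, z). (r * x, r * y, r\<^sup>2 * z))"

lemma fst_dil [simp]: "fst (dil r p) = r * fst p"
  and fst_snd_dil [simp]: "fst (snd (dil r p)) = r * fst (snd p)"
  by (simp_all add: dil_def case_prod_beta)

lemma dil_dil [simp]: "dil r (dil r' p) = dil (r * r') p"
  by (simp add: dil_def case_prod_beta power_mult_distrib)

lemma dil_1 [simp]: "dil 1 p = p"
  by (simp add: dil_def case_prod_beta)

lemma vert_dil [simp]: "vert (dil r p) (dil r q) = r\<^sup>2 * vert p q"
  by (simp add: vert_def dil_def case_prod_beta power2_eq_square algebra_simps)

lemma carnot_gauge_dil:
  assumes "0 \<le> r"
  shows "carnot_gauge (dil r p) (dil r q) = r * carnot_gauge p q"
  using assms by (simp add: carnot_gauge_def abs_mult real_sqrt_mult max_mult_distrib_left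
      flip: right_diff_distrib)


section \<open>An upper bound for the Carnot metric\<close>

lemma heis_mult_simp [simp]: "(x, y, z) \<cdot>\<^sub>H (x', y', z') = (x + x', y + y', z + z' + x * y')"
  by (simp add: heis_mult_def)

text \<open>
  Left translations carry the fields \<open>X\<close> and \<open>Y\<close> at the origin to themselves at any other point, so
  left invariance makes their lengths constant.
\<close>

lemma frechet_derivative_left_translation:
  "frechet_derivative (\<lambda>r. (x, y, z) \<cdot>\<^sub>H r) (at q) = (\<lambda>(a, b, c). (a, b, c + x * b))"
proof -
  have "((\<lambda>r. (x, y, z) \<cdot>\<^sub>H r) has_derivative (\<lambda>(a, b, c). (a, b, c + x * b))) (at q)"
    unfolding heis_mult_def case_prod_beta
    by (auto intro!: derivative_eq_intros)
  then show ?thesis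
    by (rule frechet_derivative_at[symmetric])
qed

lemma metric_X_field:
  assumes "left_invariant_riemannian g"
  shows "g p (X_field p) (X_field p) = g 0 (1, 0, 0) (1, 0, 0)"
proof (cases p)
  case (fields x y z)
  have "g (p \<cdot>\<^sub>H q) (frechet_derivative (\<lambda>r. p \<cdot>\<^sub>H r) (at q) u)
          (frechet_derivative (\<lambda>r. p \<cdot>\<^sub>H r) (at q) v) = g q u v" for q u v
    using assms unfolding left_invariant_riemannian_def by blast
  from this[of 0 "(1, 0, 0)" "(1, 0, 0)"] show ?thesis
    by (simp add: fields frechet_derivative_left_translation X_field_def zero_prod_def)
qed

lemma metric_Y_field:
  assumes "left_invariant_riemannian g"
  shows "g p (Y_field p) (Y_field p) = g 0 (0, 1, 0) (0, 1, 0)"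
proof (cases p)
  case (fields x y z)
  have "g (p \<cdot>\<^sub>H q) (frechet_derivative (\<lambda>r. p \<cdot>\<^sub>H r) (at q) u)
          (frechet_derivative (\<lambda>r. p \<cdot>\<^sub>H r) (at q) v) = g q u v" for q u v
    using assms unfolding left_invariant_riemannian_def by blast
  from this[of 0 "(0, 1, 0)" "(0, 1, 0)"] show ?thesis
    by (simp add: fields frechet_derivative_left_translation Y_field_def zero_prod_def)
qed

lemma metric_scaleR:
  assumes "left_invariant_riemannian g"
  shows "g p (c *\<^sub>R v) (c *\<^sub>R v) = c\<^sup>2 * g p v v"
proof -
  have "bilinear (g p)"
    using assms unfolding left_invariant_riemannian_def inner_product_def by blast
  then show ?thesis
    by (simp add: bilinear_lmul bilinear_rmul power2_eq_square)
qed

lemma metric_nonneg: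
  assumes "left_invariant_riemannian g"
  shows "0 \<le> g p v v"
proof (cases "v = 0")
  case True
  then show ?thesis
    using metric_scaleR[OF assms, of p 0 v] by simp
next
  case False
  then show ?thesis
    using assms unfolding left_invariant_riemannian_def inner_product_def by (meson less_imp_le)
qed

text \<open>
  Piecewise smooth horizontal curves with bounded speed. Allowing finitely many exceptional
  parameters makes the class closed under joining paths.
\<close>

definition speed_bounded_horizontal ::
    "(heis \<Rightarrow> heis \<Rightarrow> heis \<Rightarrow> real) \<Rightarrow> real \<Rightarrow> (real \<Rightarrow> heis) \<Rightarrow> bool" where
  "speed_bounded_horizontal g K \<gamma> \<longleftrightarrow> valid_path \<gamma> \<and>
     (\<exists>S. finite S \<and> (\<forall>t\<in>{0..1} - S. \<exists>v. (\<gamma> has_vector_derivative v) (at t) \<and>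
            v \<in> V1 (\<gamma> t) \<and> sqrt (g (\<gamma> t) v v) \<le> K))"

lemma speed_bounded_horizontal_join:
  assumes g: "left_invariant_riemannian g"
    and 1: "speed_bounded_horizontal g K \<gamma>\<^sub>1" and 2: "speed_bounded_horizontal g K \<gamma>\<^sub>2"
    and ends: "pathfinish \<gamma>\<^sub>1 = pathstart \<gamma>\<^sub>2"
  shows "speed_bounded_horizontal g (2 * K) (\<gamma>\<^sub>1 +++ \<gamma>\<^sub>2)"
proof -
  from 1 obtain S\<^sub>1 where S1: "finite S\<^sub>1"
    and d1: "\<And>t. t \<in> {0..1} - S\<^sub>1 \<Longrightarrow> \<exists>v. (\<gamma>\<^sub>1 has_vector_derivative v) (at t) \<and>
            v \<in> V1 (\<gamma>\<^sub>1 t) \<and> sqrt (g (\<gamma>\<^sub>1 t) v v) \<le> K"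
    unfolding speed_bounded_horizontal_def by blast
  from 2 obtain S\<^sub>2 where S2: "finite S\<^sub>2"
    and d2: "\<And>t. t \<in> {0..1} - S\<^sub>2 \<Longrightarrow> \<exists>v. (\<gamma>\<^sub>2 has_vector_derivative v) (at t) \<and>
            v \<in> V1 (\<gamma>\<^sub>2 t) \<and> sqrt (g (\<gamma>\<^sub>2 t) v v) \<le> K"
    unfolding speed_bounded_horizontal_def by blast
  define S where "S = insert (1/2) ((\<lambda>t. t / 2) ` S\<^sub>1 \<union> (\<lambda>t. (t + 1) / 2) ` S\<^sub>2)"
  have V1_scale: "2 *\<^sub>R v \<in> V1 p" if "v \<in> V1 p" for v p
    using that unfolding V1_def by (rule span_scale)
  have twice: "sqrt (g p (2 *\<^sub>R v) (2 *\<^sub>R v)) \<le> 2 * K" if "sqrt (g p v v) \<le> K" for p v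
    using that by (simp add: metric_scaleR[OF g] real_sqrt_mult)
  have "\<exists>v. ((\<gamma>\<^sub>1 +++ \<gamma>\<^sub>2) has_vector_derivative v) (at t) \<and> v \<in> V1 ((\<gamma>\<^sub>1 +++ \<gamma>\<^sub>2) t) \<and>
          sqrt (g ((\<gamma>\<^sub>1 +++ \<gamma>\<^sub>2) t) v v) \<le> 2 * K" if t: "t \<in> {0..1} - S" for t
  proof (cases "t < 1/2")
    case True
    have "2 * t \<notin> S\<^sub>1"
      using t unfolding S_def by (force dest: imageI[of _ _ "\<lambda>t. t / 2"])
    then have "2 * t \<in> {0..1} - S\<^sub>1"
      using t True by simp
    then obtain v where v: "(\<gamma>\<^sub>1 has_vector_derivative v) (at (2 * t))" "v \<in> V1 (\<gamma>\<^sub>1 (2 * t))"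
        "sqrt (g (\<gamma>\<^sub>1 (2 * t)) v v) \<le> K"
      using d1 by blast
    have "((\<lambda>t. 2 * t) has_vector_derivative 2) (at t)"
      by (auto intro!: derivative_eq_intros simp: has_vector_derivative_def)
    from vector_diff_chain_at[OF this v(1)]
    have "((\<lambda>t. \<gamma>\<^sub>1 (2 * t)) has_vector_derivative 2 *\<^sub>R v) (at t)"
      by (simp add: o_def)
    then have "((\<gamma>\<^sub>1 +++ \<gamma>\<^sub>2) has_vector_derivative 2 *\<^sub>R v) (at t)"
      by (rule has_vector_derivative_transform_within_open[where S = "{..<1/2}"])
         (use True in \<open>auto simp: joinpaths_def\<close>)
    moreover have "(\<gamma>\<^sub>1 +++ \<gamma>\<^sub>2) t = \<gamma>\<^sub>1 (2 * t)"
      using True by (simp add: joinpaths_def)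
    ultimately show ?thesis
      using v V1_scale twice by metis
  next
    case False
    then have gt: "1/2 < t"
      using t by (auto simp: S_def)
    have "2 * t - 1 \<notin> S\<^sub>2"
      using t unfolding S_def by (force dest: imageI[of _ _ "\<lambda>t. (t + 1) / 2"])
    then have "2 * t - 1 \<in> {0..1} - S\<^sub>2"
      using t gt by simp
    then obtain v where v: "(\<gamma>\<^sub>2 has_vector_derivative v) (at (2 * t - 1))"
        "v \<in> V1 (\<gamma>\<^sub>2 (2 * t - 1))" "sqrt (g (\<gamma>\<^sub>2 (2 * t - 1)) v v) \<le> K"
      using d2 by blast
    have "((\<lambda>t. 2 * t - 1) has_vector_derivative 2) (at t)"
      by (auto intro!: derivative_eq_intros simp: has_vector_derivative_def)
    from vector_diff_chain_at[OF this v(1)]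
    have "((\<lambda>t. \<gamma>\<^sub>2 (2 * t - 1)) has_vector_derivative 2 *\<^sub>R v) (at t)"
      by (simp add: o_def)
    then have "((\<gamma>\<^sub>1 +++ \<gamma>\<^sub>2) has_vector_derivative 2 *\<^sub>R v) (at t)"
      by (rule has_vector_derivative_transform_within_open[where S = "{1/2<..}"])
         (use gt in \<open>auto simp: joinpaths_def\<close>)
    moreover have "(\<gamma>\<^sub>1 +++ \<gamma>\<^sub>2) t = \<gamma>\<^sub>2 (2 * t - 1)"
      using gt by (simp add: joinpaths_def)
    ultimately show ?thesis
      using v V1_scale twice by metis
  qed
  moreover have "finite S"
    using S1 S2 by (simp add: S_def)
  moreover have "valid_path (\<gamma>\<^sub>1 +++ \<gamma>\<^sub>2)"
    using 1 2 ends unfolding speed_bounded_horizontal_def by (intro valid_path_join) auto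
  ultimately show ?thesis
    unfolding speed_bounded_horizontal_def by blast
qed

lemma speed_bounded_horizontal_mono:
  assumes "speed_bounded_horizontal g K \<gamma>" and "K \<le> K'"
  shows "speed_bounded_horizontal g K' \<gamma>"
  using assms unfolding speed_bounded_horizontal_def by (meson order_trans)

text \<open>
  The piece of \<open>\<gamma>\<close> between the two parameters is itself a competitor in the infimum that defines
  \<^const>\<open>d_R\<close>. Hence \<open>\<gamma>\<close> is Lipschitz for \<^const>\<open>d_R\<close>, and absolute continuity and the length bound
  required for \<^const>\<open>d_c\<close> follow.
\<close>

lemma d_R_le_of_speed_bounded:
  assumes g: "left_invariant_riemannian g" and \<gamma>: "speed_bounded_horizontal g K \<gamma>"
    and st: "s \<in> {0..1}" "t \<in> {0..1}"
  shows "d_R g (\<gamma> s) (\<gamma> t) \<le> ennreal (K * \<bar>t - s\<bar>)"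
proof -
  from \<gamma> obtain S where S: "finite S"
    and d: "\<And>t. t \<in> {0..1} - S \<Longrightarrow> \<exists>v. (\<gamma> has_vector_derivative v) (at t) \<and>
            v \<in> V1 (\<gamma> t) \<and> sqrt (g (\<gamma> t) v v) \<le> K"
    unfolding speed_bounded_horizontal_def by blast
  let ?\<sigma> = "subpath s t \<gamma>"
  have valid: "valid_path ?\<sigma>"
    using \<gamma> st by (auto simp: speed_bounded_horizontal_def intro: valid_path_subpath)
  \<comment> \<open>For \<open>s = t\<close> the subpath is constant, so no parameter is exceptional even if \<open>s \<in> S\<close>.\<close>
  define N where "N = {u. s \<noteq> t \<and> (t - s) * u + s \<in> S}"
  have "finite N"
  proof (cases "s = t")
    case False
    have "inj (\<lambda>u. (t - s) * u + s)"
      using False by (auto simp: inj_on_def)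
    from finite_vimageI[OF S this] show ?thesis
      by (rule rev_finite_subset) (auto simp: N_def vimage_def)
  qed (simp add: N_def)
  have speed: "sqrt (g (?\<sigma> u) (vector_derivative ?\<sigma> (at u)) (vector_derivative ?\<sigma> (at u)))
      \<le> K * \<bar>t - s\<bar>" if u: "u \<in> {0..1}" "u \<notin> N" for u
  proof (cases "s = t")
    case True
    then have "vector_derivative ?\<sigma> (at u) = 0"
      by (simp add: subpath_def)
    then show ?thesis
      using metric_scaleR[OF g, of "?\<sigma> u" 0 0] True by simp
  next
    case False
    define r where "r = (t - s) * u + s"
    have "(1 - u) * s + u * t \<in> {0..1}"
      using convexD[of "{0..1::real}" s t "1 - u" u] st u(1) by auto
    then have "r \<in> {0..1}"
      by (simp add: r_def algebra_simps)
    then obtain v where v: "(\<gamma> has_vector_derivative v) (at r)" "sqrt (g (\<gamma> r) v v) \<le> K"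
      using d[of r] u False by (auto simp: N_def r_def)
    have "((\<lambda>u. (t - s) * u + s) has_vector_derivative (t - s)) (at u)"
      by (auto intro!: derivative_eq_intros simp: has_vector_derivative_def)
    from vector_diff_chain_at[OF this] v(1)
    have "(?\<sigma> has_vector_derivative (t - s) *\<^sub>R v) (at u)"
      by (simp add: o_def r_def subpath_def)
    then have "vector_derivative ?\<sigma> (at u) = (t - s) *\<^sub>R v"
      by (rule vector_derivative_at)
    then have "sqrt (g (?\<sigma> u) (vector_derivative ?\<sigma> (at u)) (vector_derivative ?\<sigma> (at u)))
        = \<bar>t - s\<bar> * sqrt (g (\<gamma> r) v v)"
      by (simp add: metric_scaleR[OF g] real_sqrt_mult subpath_def r_def)
    also have "\<dots> \<le> K * \<bar>t - s\<bar>"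
      using v(2) by (simp add: mult.commute[of K] mult_left_mono)
    finally show ?thesis .
  qed
  have ae: "AE u in lborel. u \<notin> N"
    using \<open>finite N\<close> by (intro AE_not_in finite_imp_null_set_lborel)
  have "riemannian_length g ?\<sigma> \<le> (\<integral>\<^sup>+ u. ennreal (K * \<bar>t - s\<bar>) * indicator {0..1} (u::real) \<partial>lborel)"
    unfolding riemannian_length_def
  proof (rule nn_integral_mono_AE)
    show "AE u in lborel. ennreal (sqrt (g (?\<sigma> u) (vector_derivative ?\<sigma> (at u))
        (vector_derivative ?\<sigma> (at u)))) * indicator {0..1} u
        \<le> ennreal (K * \<bar>t - s\<bar>) * indicator {0..1} u"
      using ae by eventually_elim (auto simp: indicator_def intro!: ennreal_leI speed)
  qed
  also have "\<dots> = ennreal (K * \<bar>t - s\<bar>)"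
    by (simp add: nn_integral_cmult_indicator)
  finally have "riemannian_length g ?\<sigma> \<le> ennreal (K * \<bar>t - s\<bar>)" .
  moreover have "d_R g (\<gamma> s) (\<gamma> t) \<le> riemannian_length g ?\<sigma>"
    unfolding d_R_def using valid by (intro Inf_lower) auto
  ultimately show ?thesis
    by order
qed

lemma d_c_le_of_speed_bounded:
  assumes g: "left_invariant_riemannian g" and \<gamma>: "speed_bounded_horizontal g K \<gamma>" and K: "0 \<le> K"
  shows "d_c g (pathstart \<gamma>) (pathfinish \<gamma>) \<le> ennreal K"
proof -
  note lip = d_R_le_of_speed_bounded[OF g \<gamma>]
  have ac: "abs_continuous_curve (d_R g) \<gamma>"
    unfolding abs_continuous_curve_def
  proof (intro allI impI)
    fix \<epsilon> :: real assume \<epsilon>: "\<epsilon> > 0"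
    show "\<exists>\<delta>>0. \<forall>(n::nat) a b.
        (\<forall>i<n. 0 \<le> a i \<and> a i \<le> b i \<and> b i \<le> 1) \<and>
        disjoint_family_on (\<lambda>i. {a i<..<b i}) {..<n} \<and> (\<Sum>i<n. b i - a i) < \<delta>
        \<longrightarrow> (\<Sum>i<n. d_R g (\<gamma> (a i)) (\<gamma> (b i))) < ennreal \<epsilon>"
    proof (intro exI[of _ "\<epsilon> / (K + 1)"] conjI allI impI)
      show "\<epsilon> / (K + 1) > 0"
        using \<epsilon> K by simp
      fix n :: nat and a b :: "nat \<Rightarrow> real"
      assume ab: "(\<forall>i<n. 0 \<le> a i \<and> a i \<le> b i \<and> b i \<le> 1) \<and>
        disjoint_family_on (\<lambda>i. {a i<..<b i}) {..<n} \<and> (\<Sum>i<n. b i - a i) < \<epsilon> / (K + 1)"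
      have "(\<Sum>i<n. d_R g (\<gamma> (a i)) (\<gamma> (b i))) \<le> (\<Sum>i<n. ennreal (K * (b i - a i)))"
      proof (rule sum_mono)
        fix i assume "i \<in> {..<n}"
        then have "0 \<le> a i" "a i \<le> b i" "b i \<le> 1"
          using ab by auto
        then show "d_R g (\<gamma> (a i)) (\<gamma> (b i)) \<le> ennreal (K * (b i - a i))"
          using lip[of "a i" "b i"] by simp
      qed
      also have "\<dots> = ennreal (\<Sum>i<n. K * (b i - a i))"
        using ab K by (intro sum_ennreal) auto
      also have "\<dots> < ennreal \<epsilon>"
      proof (rule ennreal_lessI[OF \<epsilon>])
        have nonneg: "0 \<le> (\<Sum>i<n. b i - a i)"
          using ab by (intro sum_nonneg) auto
        have "(\<Sum>i<n. K * (b i - a i)) = K * (\<Sum>i<n. b i - a i)"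
          by (simp add: sum_distrib_left)
        also have "\<dots> \<le> (K + 1) * (\<Sum>i<n. b i - a i)"
          using nonneg by (simp add: algebra_simps)
        also have "\<dots> < \<epsilon>"
          using ab K by (simp add: field_simps)
        finally show "(\<Sum>i<n. K * (b i - a i)) < \<epsilon>" .
      qed
      finally show "(\<Sum>i<n. d_R g (\<gamma> (a i)) (\<gamma> (b i))) < ennreal \<epsilon>" .
    qed
  qed
  have ae: "AE t in lebesgue_on {0..1}.
      \<exists>v. (\<gamma> has_vector_derivative v) (at t within {0..1}) \<and> v \<in> V1 (\<gamma> t)"
  proof -
    from \<gamma> obtain S where S: "finite S"
      and d: "\<And>t. t \<in> {0..1} - S \<Longrightarrow> \<exists>v. (\<gamma> has_vector_derivative v) (at t) \<and>
              v \<in> V1 (\<gamma> t) \<and> sqrt (g (\<gamma> t) v v) \<le> K"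
      unfolding speed_bounded_horizontal_def by blast
    have "AE t in lebesgue. t \<notin> S"
      using S by (intro AE_not_in) (simp add: negligible_finite flip: negligible_iff_null_sets)
    then have "AE t in lebesgue. t \<in> {0..1} \<longrightarrow>
        (\<exists>v. (\<gamma> has_vector_derivative v) (at t within {0..1}) \<and> v \<in> V1 (\<gamma> t))"
    proof eventually_elim
      case (elim t)
      then show ?case
        using d by (meson DiffI has_vector_derivative_at_within)
    qed
    then show ?thesis
      by (simp add: AE_restrict_space_iff)
  qed
  have "metric_length (d_R g) \<gamma> \<le> ennreal K"
    unfolding metric_length_def
  proof (rule Sup_least)
    fix l assume "l \<in> {\<Sum>i<n. d_R g (\<gamma> (t i)) (\<gamma> (t (Suc i))) | n t.
                        mono_on {..n} t \<and> t ` {..n} \<subseteq> {0..1}}"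
    then obtain n :: nat and t :: "nat \<Rightarrow> real" where l: "l = (\<Sum>i<n. d_R g (\<gamma> (t i)) (\<gamma> (t (Suc i))))"
      and mono: "mono_on {..n} t" and range: "t ` {..n} \<subseteq> {0..1}"
      by blast
    have le: "t i \<le> t (Suc i)" if "i < n" for i
      using that by (intro mono_onD[OF mono]) auto
    have "l \<le> (\<Sum>i<n. ennreal (K * (t (Suc i) - t i)))"
      unfolding l
    proof (rule sum_mono)
      fix i assume i: "i \<in> {..<n}"
      then have "t i \<in> {0..1}" "t (Suc i) \<in> {0..1}"
        using range by (auto simp: image_subset_iff)
      then show "d_R g (\<gamma> (t i)) (\<gamma> (t (Suc i))) \<le> ennreal (K * (t (Suc i) - t i))"
        using lip[of "t i" "t (Suc i)"] le[of i] i by simp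
    qed
    also have "\<dots> = ennreal (\<Sum>i<n. K * (t (Suc i) - t i))"
      using le K by (intro sum_ennreal) auto
    also have "(\<Sum>i<n. K * (t (Suc i) - t i)) = K * (t n - t 0)"
      by (simp add: sum_lessThan_telescope flip: sum_distrib_left)
    also have "\<dots> \<le> K * 1"
    proof (rule mult_left_mono[OF _ K])
      have "t n \<le> 1" "0 \<le> t 0"
        using range by (auto simp: image_subset_iff)
      then show "t n - t 0 \<le> 1"
        by linarith
    qed
    finally show "l \<le> ennreal K"
      by (simp add: ennreal_leI)
  qed
  moreover have "d_c g (pathstart \<gamma>) (pathfinish \<gamma>) \<le> metric_length (d_R g) \<gamma>"
    unfolding d_c_def using ac ae by (intro Inf_lower) (auto simp: horizontal_curve_def)
  ultimately show ?thesis
    by order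
qed

lemma speed_bounded_horizontal_X_segment:
  assumes g: "left_invariant_riemannian g" and "K = sqrt (g 0 (1, 0, 0) (1, 0, 0))" and "\<bar>c\<bar> \<le> N"
  shows "speed_bounded_horizontal g (K * N) (linepath (x, y, z) (x + c, y, z))" (is "speed_bounded_horizontal _ _ ?\<gamma>")
proof -
  have "(?\<gamma> has_vector_derivative c *\<^sub>R X_field (?\<gamma> t)) (at t)" for t
    using has_vector_derivative_linepath_within[of "(x, y, z)" "(x + c, y, z)" t UNIV]
    by (simp add: X_field_def zero_prod_def)
  moreover have "c *\<^sub>R X_field p \<in> V1 p" for p
    unfolding V1_def by (intro span_scale span_base) simp
  moreover have "sqrt (g p (c *\<^sub>R X_field p) (c *\<^sub>R X_field p)) \<le> K * N" for p
    using mult_right_mono[OF assms(3), of K]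
    by (simp add: assms(2) metric_scaleR[OF g] metric_X_field[OF g] real_sqrt_mult
        mult.commute metric_nonneg[OF g])
  ultimately show ?thesis
    unfolding speed_bounded_horizontal_def
    by (intro conjI exI[of _ "{}"] ballI valid_path_linepath finite.emptyI) blast
qed

lemma speed_bounded_horizontal_Y_segment:
  assumes g: "left_invariant_riemannian g" and "K = sqrt (g 0 (0, 1, 0) (0, 1, 0))" and "\<bar>c\<bar> \<le> N"
  shows "speed_bounded_horizontal g (K * N) (linepath (x, y, z) (x, y + c, z + x * c))" (is "speed_bounded_horizontal _ _ ?\<gamma>")
proof -
  have "fst (?\<gamma> t) = x" for t
    by (simp add: linepath_def algebra_simps)
  then have "(?\<gamma> has_vector_derivative c *\<^sub>R Y_field (?\<gamma> t)) (at t)" for t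
    using has_vector_derivative_linepath_within[of "(x, y, z)" "(x, y + c, z + x * c)" t UNIV]
    by (simp add: Y_field_def mult.commute)
  moreover have "c *\<^sub>R Y_field p \<in> V1 p" for p
    unfolding V1_def by (intro span_scale span_base) simp
  moreover have "sqrt (g p (c *\<^sub>R Y_field p) (c *\<^sub>R Y_field p)) \<le> K * N" for p
    using mult_right_mono[OF assms(3), of K]
    by (simp add: assms(2) metric_scaleR[OF g] metric_Y_field[OF g] real_sqrt_mult
        mult.commute metric_nonneg[OF g])
  ultimately show ?thesis
    unfolding speed_bounded_horizontal_def
    by (intro conjI exI[of _ "{}"] ballI valid_path_linepath finite.emptyI) blast
qed

text \<open>
  The easy half of the ball-box theorem: the infimum defining \<^const>\<open>d_c\<close> is tested on one polygon of
  \<open>X\<close>- and \<open>Y\<close>-segments. These are straight lines in the coordinates.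
\<close>

proposition d_c_le_carnot_gauge:
  assumes g: "left_invariant_riemannian g"
  obtains C where "C > 0" and "\<And>p q. d_c g p q \<le> ennreal (C * carnot_gauge p q)"
proof -
  define K1 where "K1 = sqrt (g 0 (1, 0, 0) (1, 0, 0))"
  define K2 where "K2 = sqrt (g 0 (0, 1, 0) (0, 1, 0))"
  define K where "K = K1 + K2 + 1"
  have K: "K1 \<le> K" "K2 \<le> K" "0 < K"
    using metric_nonneg[OF g] by (auto simp: K_def K1_def K2_def add_nonneg_nonneg add_nonneg_pos)
  have "d_c g p q \<le> ennreal (8 * K * carnot_gauge p q)" for p q
  proof (cases p, cases q)
    fix x y z x' y' z' assume pq: "p = (x, y, z)" "q = (x', y', z')"
    \<comment> \<open>A \<open>Y\<close>-segment and an \<open>X\<close>-segment correct the first two coordinates and arrive at height \<open>z0\<close>;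
      the missing height \<open>\<zeta>\<close> is the signed area \<open>d * e\<close> of the rectangle traced by the commutator.\<close>
    define N where "N = carnot_gauge p q"
    define \<zeta> where "\<zeta> = vert p q"
    define d where "d = sqrt \<bar>\<zeta>\<bar>"
    define e where "e = sgn \<zeta> * d"
    define z0 where "z0 = z + x * (y' - y)"
    have N: "\<bar>x' - x\<bar> \<le> N" "\<bar>y' - y\<bar> \<le> N" "\<bar>d\<bar> \<le> N" "\<bar>e\<bar> \<le> N"
      by (auto simp: N_def carnot_gauge_def pq d_def \<zeta>_def e_def abs_mult abs_sgn_eq)
    have "N \<ge> 0"
      using N(1) by linarith
    have de: "d * e = \<zeta>"
      by (auto simp: d_def e_def sgn_if)
    have X: "speed_bounded_horizontal g (K * N) (linepath (a, b, c) (a', b, c))"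
      if "\<bar>a' - a\<bar> \<le> N" for a a' b c
      using speed_bounded_horizontal_X_segment[OF g K1_def that, of a b c] K \<open>N \<ge> 0\<close>
      by (auto elim: speed_bounded_horizontal_mono intro: mult_right_mono)
    have Y: "speed_bounded_horizontal g (K * N) (linepath (a, b, c) (a, b', c'))"
      if "\<bar>b' - b\<bar> \<le> N" "c' = c + a * (b' - b)" for a b b' c c'
      using speed_bounded_horizontal_Y_segment[OF g K2_def that(1), of a b c] K \<open>N \<ge> 0\<close> that(2)
      by (auto elim: speed_bounded_horizontal_mono intro: mult_right_mono)
    define \<gamma>1 where "\<gamma>1 = linepath (x, y, z) (x, y', z0) +++ linepath (x, y', z0) (x', y', z0)"
    define \<gamma>2 where "\<gamma>2 = linepath (x', y', z0) (x' + d, y', z0) +++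
        linepath (x' + d, y', z0) (x' + d, y' + e, z0 + (x' + d) * e)"
    define \<gamma>3 where "\<gamma>3 = linepath (x' + d, y' + e, z0 + (x' + d) * e) (x', y' + e, z0 + (x' + d) * e) +++
        linepath (x', y' + e, z0 + (x' + d) * e) (x', y', z')"
    have z': "z' = z0 + d * e"
      using de by (simp add: \<zeta>_def vert_def pq z0_def)
    \<comment> \<open>Three levels of joins turn the speed bound \<open>K * N\<close> of the six segments into \<open>8 * (K * N)\<close>.\<close>
    have 1: "speed_bounded_horizontal g (2 * (K * N)) \<gamma>1" "speed_bounded_horizontal g (2 * (K * N)) \<gamma>2"
      "speed_bounded_horizontal g (2 * (K * N)) \<gamma>3"
      unfolding \<gamma>1_def \<gamma>2_def \<gamma>3_def
      by (intro speed_bounded_horizontal_join[OF g] X Y;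
          use N z' in \<open>simp add: z0_def algebra_simps\<close>)+
    have "speed_bounded_horizontal g (2 * (2 * (K * N))) (\<gamma>2 +++ \<gamma>3)"
      by (rule speed_bounded_horizontal_join[OF g 1(2,3)]) (simp add: \<gamma>2_def \<gamma>3_def)
    moreover from 1(1) have "speed_bounded_horizontal g (2 * (2 * (K * N))) \<gamma>1"
      by (rule speed_bounded_horizontal_mono) (use K \<open>N \<ge> 0\<close> in simp)
    moreover have "pathfinish \<gamma>1 = pathstart (\<gamma>2 +++ \<gamma>3)"
      by (simp add: \<gamma>1_def \<gamma>2_def)
    ultimately have "speed_bounded_horizontal g (2 * (2 * (2 * (K * N)))) (\<gamma>1 +++ \<gamma>2 +++ \<gamma>3)"
      by (metis speed_bounded_horizontal_join[OF g])
    from d_c_le_of_speed_bounded[OF g this]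
    have "d_c g p q \<le> ennreal (8 * (K * N))"
      using K \<open>N \<ge> 0\<close> by (simp add: \<gamma>1_def \<gamma>3_def pq)
    also have "\<dots> \<le> ennreal (8 * K * N)"
      using K \<open>N \<ge> 0\<close> by (intro ennreal_leI) (simp add: algebra_simps)
    finally show ?thesis
      by (simp add: N_def)
  qed
  then show ?thesis
    using K by (intro that[of "8 * K"]) auto
qed


section \<open>Waves with Lipschitz phases\<close>

lemma norm_cis_diff_le: "norm (cis s - cis t) \<le> \<bar>s - t\<bar>"
proof -
  have "norm (cis s - cis t) \<le> 1 * norm (s - t)"
  proof (rule differentiable_bound[of UNIV cis "\<lambda>u h. h *\<^sub>R (\<i> * cis u)"])
    fix u :: real
    show "(cis has_derivative (\<lambda>h. h *\<^sub>R (\<i> * cis u))) (at u within UNIV)"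
      by (rule has_derivative_eq_rhs, rule has_derivative_cis[OF has_derivative_ident]) auto
    show "onorm (\<lambda>h. h *\<^sub>R (\<i> * cis u)) \<le> 1"
      by (rule onorm_le) (simp add: norm_mult)
  qed auto
  then show ?thesis
    by simp
qed

lemma norm_cis_minus_linear_le: "norm (cis t - (1 + \<i> * t)) \<le> t\<^sup>2"
proof -
  have "norm ((cis t - \<i> * t) - (cis 0 - \<i> * of_real 0)) \<le> \<bar>t\<bar> * norm (t - 0)"
  proof (rule differentiable_bound[of "closed_segment 0 t" "\<lambda>u. cis u - \<i> * u" "\<lambda>u h. h *\<^sub>R (\<i> * (cis u - 1))"])
    fix u :: real
    assume u: "u \<in> closed_segment 0 t"
    show "((\<lambda>u. cis u - \<i> * u) has_derivative (\<lambda>h. h *\<^sub>R (\<i> * (cis u - 1)))) (at u within closed_segment 0 t)"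
      by (auto intro!: derivative_eq_intros has_derivative_cis simp: algebra_simps scaleR_conv_of_real)
    have "norm (cis u - 1) \<le> \<bar>u\<bar>"
      using norm_cis_diff_le[of u 0] by simp
    also have "\<bar>u\<bar> \<le> \<bar>t\<bar>"
      using u by (auto simp: closed_segment_eq_real_ivl split: if_splits)
    finally show "onorm (\<lambda>h. h *\<^sub>R (\<i> * (cis u - 1))) \<le> \<bar>t\<bar>"
      by (intro onorm_le) (simp add: norm_mult mult_left_mono mult.commute[of "\<bar>t\<bar>"])
  qed auto
  then show ?thesis
    by (simp add: power2_eq_square algebra_simps abs_mult_self_eq flip: abs_mult)
qed

text \<open>A nearest point to \<open>x\<close> in the lattice of all \<open>k + 2 * n\<close> with integer \<open>n\<close>.\<close>

definition lattice_point :: "real \<Rightarrow> real \<Rightarrow> real" where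
  "lattice_point k x = 2 * of_int (round ((x - k) / 2)) + k"

lemma dist_lattice_point: "\<bar>x - lattice_point k x\<bar> \<le> 1"
  using of_int_round_abs_le[of "(x - k) / 2"] by (auto simp: lattice_point_def abs_if field_simps split: if_splits)

text \<open>
  If the nearest lattice point changes between \<open>x\<close> and \<open>x'\<close>, a midpoint between lattice points is
  passed on the way; these midpoints are the zeros of the amplitude of the waves defined next.
\<close>

lemma lattice_point_far:
  assumes "lattice_point k x \<noteq> lattice_point k x'"
  shows "1 - \<bar>x - lattice_point k x\<bar> \<le> \<bar>x' - x\<bar>"
proof -
  have "round ((x - k) / 2) \<noteq> round ((x' - k) / 2)"
    using assms by (auto simp: lattice_point_def)
  then have "1 \<le> \<bar>round ((x - k) / 2) - round ((x' - k) / 2)\<bar>"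
    by linarith
  then have "1 \<le> \<bar>of_int (round ((x - k) / 2)) - of_int (round ((x' - k) / 2)) :: real\<bar>"
    by linarith
  then have "2 \<le> \<bar>lattice_point k x - lattice_point k x'\<bar>"
    unfolding lattice_point_def by linarith
  then show ?thesis
    using dist_lattice_point[of x' k] by linarith
qed

lemma abs_cos_le_near_lattice_point:
  "\<bar>cos (pi * (x - k) / 2)\<bar> \<le> 2 * (1 - \<bar>x - lattice_point k x\<bar>)"
proof -
  define n where "n = round ((x - k) / 2)"
  define u where "u = \<bar>x - lattice_point k x\<bar>"
  \<comment> \<open>The lattice points have spacing 2, so the argument of the cosine moves by a multiple of \<open>pi\<close>.\<close>
  have "pi * (x - k) / 2 = pi * (x - lattice_point k x) / 2 + pi * of_int n"
    by (simp add: lattice_point_def n_def field_simps)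
  then have "\<bar>cos (pi * (x - k) / 2)\<bar> = \<bar>cos (pi * (x - lattice_point k x) / 2)\<bar>"
    by (simp only: cos_add) (simp add: abs_mult cos_npi_int sin_npi_int)
  also have "cos (pi * (x - lattice_point k x) / 2) = cos (pi * u / 2)"
  proof -
    have "pi * u / 2 = \<bar>pi * (x - lattice_point k x) / 2\<bar>"
      by (simp add: u_def abs_mult)
    then show ?thesis
      by (simp only: cos_abs_real)
  qed
  also have "\<dots> = sin (pi / 2 * (1 - u))"
    by (simp add: sin_cos_eq right_diff_distrib diff_divide_distrib)
  also have "\<bar>\<dots>\<bar> \<le> \<bar>pi / 2 * (1 - u)\<bar>"
    by (rule abs_sin_x_le_abs_x)
  also have "\<dots> = pi / 2 * (1 - u)"
    using dist_lattice_point[of x k] by (simp add: u_def)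
  also have "\<dots> \<le> 2 * (1 - u)"
    using dist_lattice_point[of x k] pi_less_4 by (intro mult_right_mono) (simp_all add: u_def)
  finally show ?thesis
    by (simp add: u_def)
qed

text \<open>
  On the strip \<open>\<bar>x - n\<bar> \<le> 1\<close> the function \<open>z - n * y\<close> has bounded derivatives along the left-invariant
  fields: \<open>0\<close> along \<open>X\<close>, \<open>x - n\<close> along \<open>Y\<close> and \<open>1\<close> along \<open>Z\<close>. No single function can serve as such a
  phase on the whole group: the differential of \<open>dz - x dy\<close> is minus the area form \<open>dx dy\<close>, and on large
  squares a bounded error is too small to compensate the area. Therefore the phase jumps between
  strips, where the amplitude vanishes.
\<close>

definition wave :: "real \<Rightarrow> real \<Rightarrow> heis \<Rightarrow> complex" where
  "wave m k = (\<lambda>(x, y, z). cos (pi * (x - k) / 2) * cis (m * (z - lattice_point k x * y)))"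

lemma norm_wave: "norm (wave m k (x, y, z)) = \<bar>cos (pi * (x - k) / 2)\<bar>"
  by (simp add: wave_def norm_mult)

lemma norm_wave_le: "norm (wave m k p) \<le> 1"
  by (cases p) (simp add: norm_wave)

text \<open>
  Along the vertical direction \<^const>\<open>wave\<close> rotates with frequency \<open>m\<close>, and it is Lipschitz in the
  horizontal directions.
\<close>

lemma wave_increment:
  assumes m: "1 \<le> m" "m \<le> 2" and h: "\<bar>vert p q\<bar> \<le> 1"
  shows "norm (wave m k q - (1 + \<i> * of_real (m * vert p q)) * wave m k p)
    \<le> 8 * (\<bar>fst q - fst p\<bar> + \<bar>fst (snd q) - fst (snd p)\<bar> + (vert p q)\<^sup>2)"
proof (cases p, cases q)
  fix x y z x' y' z' assume pq: "p = (x, y, z)" "q = (x', y', z')"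
  define a where "a = x' - x"
  define b where "b = y' - y"
  define c where "c = vert p q"
  define wt where "wt x = cos (pi * (x - k) / 2)" for x
  define n where "n = lattice_point k x"
  have z': "z' = z + c + x * b"
    by (simp add: c_def vert_def pq b_def)
  have lin: "norm (1 + \<i> * of_real (m * c)) \<le> 3"
  proof -
    have "norm (1 + \<i> * of_real (m * c)) \<le> 1 + m * \<bar>c\<bar>"
      using norm_triangle_ineq[of 1 "\<i> * of_real (m * c)"] m by (simp add: norm_mult abs_mult)
    also have "m * \<bar>c\<bar> \<le> 2 * 1"
      using m h by (intro mult_mono) (auto simp: c_def)
    finally show ?thesis by simp
  qed
  have "norm (wave m k q - (1 + \<i> * of_real (m * c)) * wave m k p) \<le> 8 * (\<bar>a\<bar> + \<bar>b\<bar> + c\<^sup>2)"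
  proof (cases "lattice_point k x' = n")
    case True
    \<comment> \<open>Both points use the same phase \<open>z - n * y\<close>, whose increment is \<open>c + (x - n) * b\<close> with \<open>\<bar>x - n\<bar> \<le> 1\<close>.\<close>
    define \<theta> where "\<theta> = m * (z - n * y)"
    define \<phi> where "\<phi> = m * (c + (x - n) * b)"
    have q: "wave m k q = wt x' * (cis \<theta> * cis \<phi>)"
      by (simp add: wave_def pq True wt_def cis_mult \<theta>_def \<phi>_def z' b_def algebra_simps)
    have p: "wave m k p = wt x * cis \<theta>"
      by (simp add: wave_def pq wt_def \<theta>_def n_def)
    have "wave m k q - (1 + \<i> * of_real (m * c)) * wave m k p =
       (wt x' - wt x) * (cis \<theta> * cis \<phi>) + wt x * cis \<theta> * (cis \<phi> - cis (m * c))
       + wt x * cis \<theta> * (cis (m * c) - (1 + \<i> * of_real (m * c)))"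
      unfolding p q by (simp add: algebra_simps)
    also have "norm \<dots> \<le> \<bar>wt x' - wt x\<bar> + \<bar>\<phi> - m * c\<bar> + (m * c)\<^sup>2"
    proof (intro norm_triangle_mono)
      show "norm ((wt x' - wt x) * (cis \<theta> * cis \<phi>)) \<le> \<bar>wt x' - wt x\<bar>"
        by (simp add: norm_mult flip: of_real_diff)
      have le: "norm (wt x * cis \<theta> * w) \<le> norm w" for w
        by (simp add: norm_mult wt_def mult_left_le_one_le)
      show "norm (wt x * cis \<theta> * (cis \<phi> - cis (m * c))) \<le> \<bar>\<phi> - m * c\<bar>"
        using le norm_cis_diff_le by (rule order_trans)
      show "norm (wt x * cis \<theta> * (cis (m * c) - (1 + \<i> * of_real (m * c)))) \<le> (m * c)\<^sup>2"
        using le norm_cis_minus_linear_le by (rule order_trans)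
    qed
    finally have 1: "norm (wave m k q - (1 + \<i> * of_real (m * c)) * wave m k p)
        \<le> \<bar>wt x' - wt x\<bar> + \<bar>\<phi> - m * c\<bar> + (m * c)\<^sup>2" .
    have 2: "\<bar>wt x' - wt x\<bar> \<le> 2 * \<bar>a\<bar>"
    proof -
      have "wt t = Re (cis (pi * (t - k) / 2))" for t
        by (simp add: wt_def)
      then have "\<bar>wt x' - wt x\<bar> \<le> norm (cis (pi * (x' - k) / 2) - cis (pi * (x - k) / 2))"
        by (metis abs_Re_le_cmod minus_complex.sel(1))
      also have "\<dots> \<le> \<bar>pi * (x' - k) / 2 - pi * (x - k) / 2\<bar>"
        by (rule norm_cis_diff_le)
      also have "\<dots> = pi / 2 * \<bar>a\<bar>"
        by (simp add: a_def abs_mult flip: diff_divide_distrib right_diff_distrib)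
      also have "\<dots> \<le> 2 * \<bar>a\<bar>"
        using pi_less_4 by (intro mult_right_mono) auto
      finally show ?thesis .
    qed
    have 3: "\<bar>\<phi> - m * c\<bar> \<le> 2 * \<bar>b\<bar>"
    proof -
      have "\<phi> - m * c = m * (x - n) * b"
        by (simp add: \<phi>_def algebra_simps)
      then have "\<bar>\<phi> - m * c\<bar> = m * \<bar>x - n\<bar> * \<bar>b\<bar>"
        using m by (simp add: abs_mult)
      also have "\<dots> \<le> 2 * 1 * \<bar>b\<bar>"
        using m dist_lattice_point[of x k] by (intro mult_mono) (auto simp: n_def)
      finally show ?thesis by simp
    qed
    have 4: "(m * c)\<^sup>2 \<le> 4 * c\<^sup>2"
      using m power_mono[of m 2 2] by (simp add: power_mult_distrib mult_right_mono)
    show ?thesis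
      using 1 2 3 4 zero_le_power2[of c] by argo
  next
    case False
    \<comment> \<open>The phases are unrelated, but then both amplitudes are small.\<close>
    have p: "\<bar>wt x\<bar> \<le> 2 * \<bar>a\<bar>"
      using lattice_point_far[of k x x'] abs_cos_le_near_lattice_point[of x k] False
      by (simp add: wt_def a_def n_def)
    have q: "\<bar>wt x'\<bar> \<le> 2 * \<bar>a\<bar>"
      using lattice_point_far[of k x' x] abs_cos_le_near_lattice_point[of x' k] False
      by (simp add: wt_def a_def n_def abs_minus_commute)
    have "norm (wave m k q - (1 + \<i> * of_real (m * c)) * wave m k p)
        \<le> norm (wave m k q) + norm (1 + \<i> * of_real (m * c)) * norm (wave m k p)"
      using norm_triangle_ineq4[of "wave m k q" "(1 + \<i> * of_real (m * c)) * wave m k p"]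
      by (simp only: norm_mult)
    also have "\<dots> \<le> 2 * \<bar>a\<bar> + 3 * (2 * \<bar>a\<bar>)"
      using p q lin by (intro add_mono mult_mono) (auto simp: norm_wave pq wt_def)
    also have "\<dots> \<le> 8 * (\<bar>a\<bar> + \<bar>b\<bar> + c\<^sup>2)"
      by simp
    finally show ?thesis .
  qed
  then show ?thesis
    by (simp add: a_def b_def c_def pq)
qed

text \<open>
  The amplitudes of the waves centred at even and at odd integers are a cosine and the corresponding
  sine. So two families of strips suffice, and they can be told apart by two frequencies.
\<close>

lemma norm_wave_partition: "(norm (wave m 0 p))\<^sup>2 + (norm (wave m' 1 p))\<^sup>2 = 1"
proof (cases p)
  case (fields x y z)
  have "cos (pi * (x - 1) / 2) = sin (pi * x / 2)"
    by (simp add: right_diff_distrib diff_divide_distrib cos_diff)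
  then show ?thesis
    by (simp add: fields norm_wave)
qed


section \<open>Coiling vertical lines into horizontal curves\<close>

text \<open>
  Write \<open>a\<close>, \<open>b\<close>, \<open>e\<close> for the three shifts below. The point \<open>p \<cdot> (a, b, e)\<close> moves horizontally along
  vertical lines iff \<open>1 + \<partial>\<^sub>z e - a * \<partial>\<^sub>z b = 0\<close>. Here \<open>\<partial>\<^sub>z b = a\<close>, because the second wave, of frequency 2,
  is divided by 2 in \<open>b\<close>; so \<open>e\<close> has to be a primitive of \<open>a\<^sup>2 - 1\<close>, and it stays bounded because the
  mean of \<open>a\<^sup>2\<close> along the line is 1. The mixed terms do not contribute to this mean, as the two waves
  have different frequencies, whatever their phases. The four terms of \<open>e\<close> come from the frequencies
  2, 4, 3 and 1 present in \<open>a\<^sup>2\<close>.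
\<close>

definition coil_shift_x :: "heis \<Rightarrow> real" where
  "coil_shift_x p = sqrt 2 * Re (wave 1 0 p + wave 2 1 p)"

definition coil_shift_y :: "heis \<Rightarrow> real" where
  "coil_shift_y p = sqrt 2 * Im (wave 1 0 p + wave 2 1 p / 2)"

definition coil_shift_z :: "heis \<Rightarrow> real" where
  "coil_shift_z p = (let u = wave 1 0 p; v = wave 2 1 p in
     Im (u\<^sup>2) / 2 + Im (v\<^sup>2) / 4 + 2 * Im (u * v) / 3 + 2 * Im (v * cnj u))"

text \<open>
  Vertical lines become horizontal curves that spiral around them. In the plane of \<open>x\<close> and \<open>y\<close> they run
  around loops, and the enclosed signed area provides the height.
\<close>

definition coil :: "heis \<Rightarrow> heis" where
  "coil p = p \<cdot>\<^sub>H (coil_shift_x p, coil_shift_y p, coil_shift_z p)"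

text \<open>The product rule for rotations: frequencies add, and the errors remain of the same order.\<close>

lemma linear_increment_mult:
  fixes u u' v v' :: complex and \<mu> \<nu> h \<kappa> :: real
  assumes u: "norm (u' - (1 + \<i> * of_real (\<mu> * h)) * u) \<le> \<kappa>" "norm u \<le> 1" "norm u' \<le> 1"
    and v: "norm (v' - (1 + \<i> * of_real (\<nu> * h)) * v) \<le> \<kappa>" "norm v \<le> 1"
    and h: "\<bar>h\<bar> \<le> 1" and \<mu>: "\<bar>\<mu>\<bar> \<le> 2" and \<nu>: "\<bar>\<nu>\<bar> \<le> 2"
  shows "norm (u' * v' - (1 + \<i> * of_real ((\<mu> + \<nu>) * h)) * (u * v)) \<le> 4 * \<kappa> + 4 * h\<^sup>2"
proof -
  have lin: "norm (1 + \<i> * of_real (\<nu> * h)) \<le> 3"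
  proof -
    have "norm (1 + \<i> * of_real (\<nu> * h)) \<le> 1 + \<bar>\<nu>\<bar> * \<bar>h\<bar>"
      using norm_triangle_ineq[of 1 "\<i> * of_real (\<nu> * h)"] by (simp add: norm_mult abs_mult)
    also have "\<bar>\<nu>\<bar> * \<bar>h\<bar> \<le> 2 * 1"
      using \<nu> h by (intro mult_mono) auto
    finally show ?thesis by simp
  qed
  have "u' * v' - (1 + \<i> * of_real ((\<mu> + \<nu>) * h)) * (u * v) =
      u' * (v' - (1 + \<i> * of_real (\<nu> * h)) * v)
      + (u' - (1 + \<i> * of_real (\<mu> * h)) * u) * ((1 + \<i> * of_real (\<nu> * h)) * v)
      - of_real (\<mu> * \<nu> * h\<^sup>2) * (u * v)"
    by (simp add: algebra_simps power2_eq_square)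
  also have "norm \<dots> \<le> norm (u' * (v' - (1 + \<i> * of_real (\<nu> * h)) * v))
      + norm ((u' - (1 + \<i> * of_real (\<mu> * h)) * u) * ((1 + \<i> * of_real (\<nu> * h)) * v))
      + norm (of_real (\<mu> * \<nu> * h\<^sup>2) * (u * v))"
    by (rule order_trans[OF norm_triangle_ineq4 add_right_mono[OF norm_triangle_ineq]])
  also have "\<dots> \<le> 1 * \<kappa> + \<kappa> * (3 * 1) + (2 * 2 * h\<^sup>2) * (1 * 1)"
    unfolding norm_mult norm_of_real abs_mult abs_power2
    using u v lin \<mu> \<nu> order_trans[OF norm_ge_zero u(1)]
    by (intro add_mono mult_mono) auto
  finally show ?thesis
    by simp
qed

lemma coil_shift_bounded:
  "\<bar>coil_shift_x p\<bar> \<le> 4" "\<bar>coil_shift_y p\<bar> \<le> 4" "\<bar>coil_shift_z p\<bar> \<le> 4"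
proof -
  define u v where "u = wave 1 0 p" and "v = wave 2 1 p"
  have u: "norm u \<le> 1" and v: "norm v \<le> 1"
    by (simp_all add: u_def v_def norm_wave_le)
  have s: "sqrt 2 \<le> 2"
    by (simp add: real_le_lsqrt)
  have re: "\<bar>Re w\<bar> \<le> norm w" and im: "\<bar>Im w\<bar> \<le> norm w" for w
    by (simp_all add: abs_Re_le_cmod abs_Im_le_cmod)
  have "\<bar>Re (u + v)\<bar> \<le> 2"
    using re[of u] re[of v] u v by simp
  then have "sqrt 2 * \<bar>Re (u + v)\<bar> \<le> 2 * 2"
    using s by (intro mult_mono) auto
  then show "\<bar>coil_shift_x p\<bar> \<le> 4"
    by (simp add: coil_shift_x_def u_def v_def abs_mult)
  have "\<bar>Im (u + v / 2)\<bar> \<le> 2"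
    using im[of u] im[of v] u v by simp
  then have "sqrt 2 * \<bar>Im (u + v / 2)\<bar> \<le> 2 * 2"
    using s by (intro mult_mono) auto
  then show "\<bar>coil_shift_y p\<bar> \<le> 4"
    by (simp add: coil_shift_y_def u_def v_def abs_mult)
  have prod: "\<bar>Im (a * b)\<bar> \<le> 1" if "norm a \<le> 1" "norm b \<le> 1" for a b :: complex
    using order_trans[OF im[of "a * b"]] that by (simp add: norm_mult mult_le_one)
  have "\<bar>Im (u\<^sup>2)\<bar> \<le> 1" "\<bar>Im (v\<^sup>2)\<bar> \<le> 1" "\<bar>Im (u * v)\<bar> \<le> 1" "\<bar>Im (v * cnj u)\<bar> \<le> 1"
    using u v by (auto simp only: power2_eq_square complex_mod_cnj intro!: prod)
  then show "\<bar>coil_shift_z p\<bar> \<le> 4"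
    unfolding coil_shift_z_def Let_def u_def[symmetric] v_def[symmetric] by linarith
qed

text \<open>
  Taylor expansion in the vertical direction, with Lipschitz errors in the horizontal directions: the
  vertical derivatives of the last two shifts are \<open>a\<close> and \<open>a\<^sup>2 - 1\<close>, where \<open>a\<close> is the first shift.
\<close>

lemma coil_shift_increment:
  assumes h: "\<bar>vert p q\<bar> \<le> 1"
  defines "\<eta> \<equiv> \<bar>fst q - fst p\<bar> + \<bar>fst (snd q) - fst (snd p)\<bar> + (vert p q)\<^sup>2"
  shows "\<bar>coil_shift_x q - coil_shift_x p\<bar> \<le> 6 * \<bar>vert p q\<bar> + 32 * \<eta>"
    and "\<bar>coil_shift_y q - coil_shift_y p - vert p q * coil_shift_x p\<bar> \<le> 24 * \<eta>"
    and "\<bar>coil_shift_z q - coil_shift_z p - vert p q * ((coil_shift_x p)\<^sup>2 - 1)\<bar> \<le> 144 * \<eta>"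
proof -
  define h where "h = vert p q"
  define u v where "u = wave 1 0 p" and "v = wave 2 1 p"
  define u' v' where "u' = wave 1 0 q" and "v' = wave 2 1 q"
  note uv_defs = u_def[symmetric] v_def[symmetric] u'_def[symmetric] v'_def[symmetric]
  have n: "norm u \<le> 1" "norm v \<le> 1" "norm u' \<le> 1" "norm v' \<le> 1"
    by (simp_all add: u_def v_def u'_def v'_def norm_wave_le)
  have h1: "\<bar>h\<bar> \<le> 1"
    using h by (simp add: h_def)
  have \<eta>0: "h\<^sup>2 \<le> \<eta>" "0 \<le> \<eta>"
    by (simp_all add: \<eta>_def h_def)
  have s: "sqrt 2 \<le> 2"
    by (simp add: real_le_lsqrt)
  \<comment> \<open>The increments of all products of the waves have the same form as those of the waves: a rotation
    by frequency times \<open>h\<close>, up to an error of order \<open>\<eta>\<close>.\<close>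
  define ru where "ru = u' - (1 + \<i> * of_real (1 * h)) * u"
  define rv where "rv = v' - (1 + \<i> * of_real (2 * h)) * v"
  have ru: "norm ru \<le> 8 * \<eta>"
    using wave_increment[of 1 p q 0] h by (simp add: ru_def u_def u'_def h_def \<eta>_def)
  have rv: "norm rv \<le> 8 * \<eta>"
    using wave_increment[of 2 p q 1] h by (simp add: rv_def v_def v'_def h_def \<eta>_def)
  have re: "\<bar>Re w\<bar> \<le> norm w" and im: "\<bar>Im w\<bar> \<le> norm w" for w
    by (simp_all add: abs_Re_le_cmod abs_Im_le_cmod)
  have "coil_shift_x q - coil_shift_x p = sqrt 2 * (Re ru + Re rv - h * Im u - 2 * h * Im v)"
    unfolding coil_shift_x_def uv_defs by (simp add: ru_def rv_def algebra_simps)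
  then have "\<bar>coil_shift_x q - coil_shift_x p\<bar> = sqrt 2 * \<bar>Re ru + Re rv - h * Im u - 2 * h * Im v\<bar>"
    by (simp add: abs_mult)
  also have "\<bar>Re ru + Re rv - h * Im u - 2 * h * Im v\<bar> \<le> 3 * \<bar>h\<bar> + 16 * \<eta>"
  proof -
    have "\<bar>h * Im u\<bar> \<le> \<bar>h\<bar> * 1" "\<bar>h * Im v\<bar> \<le> \<bar>h\<bar> * 1"
      unfolding abs_mult using im[of u] im[of v] n by (intro mult_left_mono; linarith)+
    then show ?thesis
      using re[of ru] re[of rv] ru rv by linarith
  qed
  finally have "\<bar>coil_shift_x q - coil_shift_x p\<bar> \<le> sqrt 2 * (3 * \<bar>h\<bar> + 16 * \<eta>)"
    by simp
  also have "\<dots> \<le> 2 * (3 * \<bar>h\<bar> + 16 * \<eta>)"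
    using s \<eta>0 by (intro mult_right_mono) auto
  finally show "\<bar>coil_shift_x q - coil_shift_x p\<bar> \<le> 6 * \<bar>vert p q\<bar> + 32 * \<eta>"
    by (simp add: h_def)
  have "coil_shift_y q - coil_shift_y p - h * coil_shift_x p = sqrt 2 * (Im ru + Im rv / 2)"
    unfolding coil_shift_x_def coil_shift_y_def uv_defs
    by (simp add: ru_def rv_def algebra_simps diff_divide_distrib add_divide_distrib)
  then have "\<bar>coil_shift_y q - coil_shift_y p - h * coil_shift_x p\<bar> = sqrt 2 * \<bar>Im ru + Im rv / 2\<bar>"
    by (simp add: abs_mult)
  also have "\<dots> \<le> 2 * (12 * \<eta>)"
    using s im[of ru] im[of rv] ru rv by (intro mult_mono) auto
  finally show "\<bar>coil_shift_y q - coil_shift_y p - vert p q * coil_shift_x p\<bar> \<le> 24 * \<eta>"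
    by (simp add: h_def)
  have rcu: "norm (cnj u' - (1 + \<i> * of_real (-1 * h)) * cnj u) \<le> 8 * \<eta>"
  proof -
    have "cnj u' - (1 + \<i> * of_real (-1 * h)) * cnj u = cnj ru"
      by (simp add: ru_def)
    then show ?thesis
      using ru by simp
  qed
  define ruu where "ruu = u' * u' - (1 + \<i> * of_real ((1 + 1) * h)) * (u * u)"
  define rvv where "rvv = v' * v' - (1 + \<i> * of_real ((2 + 2) * h)) * (v * v)"
  define ruv where "ruv = u' * v' - (1 + \<i> * of_real ((1 + 2) * h)) * (u * v)"
  define rvcu where "rvcu = v' * cnj u' - (1 + \<i> * of_real ((2 + -1) * h)) * (v * cnj u)"
  have r: "norm ruu \<le> 4 * (8 * \<eta>) + 4 * h\<^sup>2" "norm rvv \<le> 4 * (8 * \<eta>) + 4 * h\<^sup>2"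
    "norm ruv \<le> 4 * (8 * \<eta>) + 4 * h\<^sup>2" "norm rvcu \<le> 4 * (8 * \<eta>) + 4 * h\<^sup>2"
    unfolding ruu_def rvv_def ruv_def rvcu_def
    using n h1 ru rv rcu by (auto intro!: linear_increment_mult simp only: ru_def rv_def complex_mod_cnj)
  \<comment> \<open>The oscillating part of \<open>2 * (Re u + Re v)\<^sup>2\<close> remains after the constant mean, the squared
    amplitude, is subtracted.\<close>
  have unit: "(Re u)\<^sup>2 + (Im u)\<^sup>2 + ((Re v)\<^sup>2 + (Im v)\<^sup>2) = 1"
    using norm_wave_partition[of 1 p 2] by (simp add: cmod_power2 flip: u_def v_def)
  have "(coil_shift_x p)\<^sup>2 - 1 = 2 * (Re u + Re v)\<^sup>2 - ((Re u)\<^sup>2 + (Im u)\<^sup>2 + ((Re v)\<^sup>2 + (Im v)\<^sup>2))"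
    unfolding unit coil_shift_x_def uv_defs by (simp add: power_mult_distrib)
  also have "\<dots> = Re (u * u) + Re (v * v) + 2 * Re (u * v) + 2 * Re (v * cnj u)"
    by (simp add: power2_eq_square algebra_simps)
  finally have sq: "(coil_shift_x p)\<^sup>2 - 1 = Re (u * u) + Re (v * v) + 2 * Re (u * v) + 2 * Re (v * cnj u)" .
  have "coil_shift_z q - coil_shift_z p - h * ((coil_shift_x p)\<^sup>2 - 1) =
      Im ruu / 2 + Im rvv / 4 + 2 * Im ruv / 3 + 2 * Im rvcu"
    unfolding sq coil_shift_z_def uv_defs Let_def
    by (simp add: ruu_def rvv_def ruv_def rvcu_def power2_eq_square field_simps)
  also have "\<bar>\<dots>\<bar> \<le> 4 * (4 * (8 * \<eta>) + 4 * h\<^sup>2)"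
  proof -
    have R: "\<bar>Im w\<bar> \<le> R" if "norm w \<le> R" for w R
      using im[of w] that by (rule order_trans)
    have "\<bar>\<xi>\<^sub>1 / 2 + \<xi>\<^sub>2 / 4 + 2 * \<xi>\<^sub>3 / 3 + 2 * \<xi>\<^sub>4\<bar> \<le> 4 * R"
      if "\<bar>\<xi>\<^sub>1\<bar> \<le> R" "\<bar>\<xi>\<^sub>2\<bar> \<le> R" "\<bar>\<xi>\<^sub>3\<bar> \<le> R" "\<bar>\<xi>\<^sub>4\<bar> \<le> R" for \<xi>\<^sub>1 \<xi>\<^sub>2 \<xi>\<^sub>3 \<xi>\<^sub>4 R :: real
      using that by linarith
    from this[OF R[OF r(1)] R[OF r(2)] R[OF r(3)] R[OF r(4)]] show ?thesis .
  qed
  also have "\<dots> \<le> 144 * \<eta>"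
    using \<eta>0 by argo
  finally show "\<bar>coil_shift_z q - coil_shift_z p - vert p q * ((coil_shift_x p)\<^sup>2 - 1)\<bar> \<le> 144 * \<eta>"
    by (simp add: h_def)
qed

lemma fst_coil: "fst (coil p) = fst p + coil_shift_x p"
  and snd_coil: "fst (snd (coil p)) = fst (snd p) + coil_shift_y p"
  by (cases p, simp add: coil_def heis_mult_def)+

lemma vert_coil:
  "vert (coil p) (coil q) = vert p q + (coil_shift_z q - coil_shift_z p)
     - coil_shift_x p * (coil_shift_y q - coil_shift_y p)
     + (fst q - fst p) * coil_shift_y q - (fst (snd q) - fst (snd p)) * coil_shift_x p"
  by (cases p, cases q) (simp add: vert_def coil_def heis_mult_def algebra_simps)

text \<open>
  The last bound says that images of vertical lines are horizontal: to first order, moving vertically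
  by \<open>vert p q\<close> produces no vertical displacement of the image, only a quadratic one.
\<close>

lemma coil_increment:
  assumes "\<bar>vert p q\<bar> \<le> 1"
  defines "\<eta> \<equiv> \<bar>fst q - fst p\<bar> + \<bar>fst (snd q) - fst (snd p)\<bar> + (vert p q)\<^sup>2"
  shows "\<bar>fst (coil q) - fst (coil p)\<bar> \<le> 300 * (\<bar>vert p q\<bar> + \<eta>)"
    and "\<bar>fst (snd (coil q)) - fst (snd (coil p))\<bar> \<le> 300 * (\<bar>vert p q\<bar> + \<eta>)"
    and "\<bar>vert (coil p) (coil q)\<bar> \<le> 300 * \<eta>"
proof -
  define h where "h = vert p q"
  define dx dy where "dx = fst q - fst p" and "dy = fst (snd q) - fst (snd p)"
  define a b e where "a = coil_shift_x p" and "b = coil_shift_y p" and "e = coil_shift_z p"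
  define a' b' e' where "a' = coil_shift_x q" and "b' = coil_shift_y q" and "e' = coil_shift_z q"
  have d: "\<bar>dx\<bar> \<le> \<eta>" "\<bar>dy\<bar> \<le> \<eta>" "\<bar>dx\<bar> + \<bar>dy\<bar> \<le> \<eta>" "0 \<le> \<eta>"
    by (auto simp: \<eta>_def dx_def dy_def)
  note inc = coil_shift_increment[OF assms(1), folded \<eta>_def h_def a_def b_def e_def a'_def b'_def e'_def]
  note bnd = coil_shift_bounded[of p, folded a_def b_def e_def] coil_shift_bounded[of q, folded a'_def b'_def e'_def]
  show "\<bar>fst (coil q) - fst (coil p)\<bar> \<le> 300 * (\<bar>vert p q\<bar> + \<eta>)"
  proof -
    have "fst (coil q) - fst (coil p) = dx + (a' - a)"
      by (simp add: fst_coil dx_def a_def a'_def)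
    also have "\<bar>\<dots>\<bar> \<le> \<bar>dx\<bar> + \<bar>a' - a\<bar>"
      by (rule abs_triangle_ineq)
    also have "\<dots> \<le> \<eta> + (6 * \<bar>h\<bar> + 32 * \<eta>)"
      by (rule add_mono[OF d(1) inc(1)])
    also have "\<dots> \<le> 300 * (\<bar>h\<bar> + \<eta>)"
      using d(4) by simp
    finally show ?thesis
      by (simp only: h_def)
  qed
  have ha: "\<bar>h * a\<bar> \<le> \<bar>h\<bar> * 4"
    unfolding abs_mult using bnd by (intro mult_left_mono) auto
  show "\<bar>fst (snd (coil q)) - fst (snd (coil p))\<bar> \<le> 300 * (\<bar>vert p q\<bar> + \<eta>)"
  proof -
    have "fst (snd (coil q)) - fst (snd (coil p)) = dy + (b' - b - h * a) + h * a"
      by (simp add: snd_coil dy_def b_def b'_def)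
    also have "\<bar>\<dots>\<bar> \<le> \<bar>dy\<bar> + \<bar>b' - b - h * a\<bar> + \<bar>h * a\<bar>"
      by (rule order_trans[OF abs_triangle_ineq add_right_mono[OF abs_triangle_ineq]])
    also have "\<dots> \<le> \<eta> + 24 * \<eta> + \<bar>h\<bar> * 4"
      by (rule add_mono[OF add_mono[OF d(2) inc(2)] ha])
    also have "\<dots> \<le> 300 * (\<bar>h\<bar> + \<eta>)"
      using d(4) by simp
    finally show ?thesis
      by (simp only: h_def)
  qed
  have b'le: "\<bar>b'\<bar> \<le> 4" and ale: "\<bar>a\<bar> \<le> 4"
    using bnd by auto
  \<comment> \<open>The terms of first order in \<open>h\<close> cancel: \<open>h + h * (a\<^sup>2 - 1) - a * (h * a) = 0\<close>.\<close>
  have "vert (coil p) (coil q) = (e' - e - h * (a\<^sup>2 - 1)) - a * (b' - b - h * a) + dx * b' - dy * a"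
    unfolding vert_coil
    by (simp only: h_def[symmetric] a_def[symmetric] b_def[symmetric] e_def[symmetric]
        a'_def[symmetric] b'_def[symmetric] e'_def[symmetric] dx_def[symmetric] dy_def[symmetric])
       (simp add: algebra_simps power2_eq_square)
  also have "\<bar>\<dots>\<bar> \<le> \<bar>e' - e - h * (a\<^sup>2 - 1)\<bar> + \<bar>a * (b' - b - h * a)\<bar> + \<bar>dx * b'\<bar> + \<bar>dy * a\<bar>"
  proof -
    have "\<bar>\<xi>\<^sub>1 - \<xi>\<^sub>2 + \<xi>\<^sub>3 - \<xi>\<^sub>4\<bar> \<le> \<bar>\<xi>\<^sub>1\<bar> + \<bar>\<xi>\<^sub>2\<bar> + \<bar>\<xi>\<^sub>3\<bar> + \<bar>\<xi>\<^sub>4\<bar>" for \<xi>\<^sub>1 \<xi>\<^sub>2 \<xi>\<^sub>3 \<xi>\<^sub>4 :: real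
      by linarith
    then show ?thesis .
  qed
  also have "\<dots> \<le> 144 * \<eta> + 4 * (24 * \<eta>) + \<bar>dx\<bar> * 4 + \<bar>dy\<bar> * 4"
    unfolding abs_mult
    by (intro add_mono[OF add_mono[OF add_mono]] inc(3) mult_mono[OF ale inc(2)]
        mult_left_mono[OF b'le] mult_left_mono[OF ale]) auto
  also have "\<dots> \<le> 300 * \<eta>"
    using d(3,4) by argo
  finally show "\<bar>vert (coil p) (coil q)\<bar> \<le> 300 * \<eta>" .
qed

lemma carnot_gauge_coil: "carnot_gauge (coil p) p \<le> 5"
proof -
  have "vert (coil p) p = coil_shift_x p * coil_shift_y p - coil_shift_z p"
    by (cases p) (simp add: coil_def vert_def algebra_simps heis_mult_def)
  moreover have "\<bar>coil_shift_x p * coil_shift_y p\<bar> \<le> 4 * 4"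
    unfolding abs_mult using coil_shift_bounded by (intro mult_mono) auto
  ultimately have "\<bar>vert (coil p) p\<bar> \<le> 5\<^sup>2"
    using coil_shift_bounded(3)[of p] by simp
  then show ?thesis
    using coil_shift_bounded[of p] by (subst carnot_gauge_le_iff) (auto simp: fst_coil snd_coil)
qed


section \<open>Hoelder maps close to the identity\<close>

text \<open>
  A perturbation of \<open>dil (t\<^sup>2)\<close>. The first dilation stretches vertical vectors by \<open>t\<^sup>2\<close>, the coil turns them
  into horizontal ones, and the second dilation stretches these by \<open>t\<close> only. Horizontal vectors are
  stretched by \<open>t\<close> first and by at most \<open>t\<^sup>2\<close> afterwards. In both cases the total is of order \<open>t ^ 3\<close>,
  whereas \<open>dil (t\<^sup>2)\<close> itself stretches vertical vectors by \<open>t ^ 4\<close>.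
\<close>

definition stretch :: "real \<Rightarrow> heis \<Rightarrow> heis" where
  "stretch t p = dil t (coil (dil t p))"

lemma carnot_gauge_stretch:
  assumes "0 \<le> t"
  shows "carnot_gauge (stretch t p) (dil (t\<^sup>2) p) \<le> 5 * t"
proof -
  have "carnot_gauge (stretch t p) (dil t (dil t p)) = t * carnot_gauge (coil (dil t p)) (dil t p)"
    unfolding stretch_def using assms by (rule carnot_gauge_dil)
  then show ?thesis
    using mult_left_mono[OF carnot_gauge_coil assms] by (simp add: power2_eq_square mult.commute)
qed

lemma riemannian_gauge_stretch:
  assumes t: "1 \<le> t" and small: "riemannian_gauge p q \<le> 1 / t ^ 3"
  shows "riemannian_gauge (stretch t p) (stretch t q) \<le> 1200 * t ^ 3 * riemannian_gauge p q"
proof -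
  define \<rho> where "\<rho> = riemannian_gauge p q"
  define P Q where "P = dil t p" and "Q = dil t q"
  define dx dy h where "dx = fst q - fst p" and "dy = fst (snd q) - fst (snd p)" and "h = vert p q"
  have \<rho>: "\<bar>dx\<bar> \<le> \<rho>" "\<bar>dy\<bar> \<le> \<rho>" "\<bar>h\<bar> \<le> \<rho>" "0 \<le> \<rho>"
    by (auto simp: \<rho>_def riemannian_gauge_def dx_def dy_def h_def)
  have \<rho>t: "\<rho> * t ^ 3 \<le> 1"
    using small t by (simp add: \<rho>_def field_simps)
  have PQ: "fst Q - fst P = t * dx" "fst (snd Q) - fst (snd P) = t * dy" "vert P Q = t\<^sup>2 * h"
    by (simp_all add: P_def Q_def dx_def dy_def h_def right_diff_distrib)
  have t2: "t \<le> t\<^sup>2" "t\<^sup>2 \<le> t ^ 3"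
    using t by (simp_all add: power2_eq_square power3_eq_cube)
  have small_vert: "\<bar>vert P Q\<bar> \<le> t\<^sup>2 * \<rho>"
    using \<rho> by (simp add: PQ abs_mult mult_left_mono)
  also have "\<dots> \<le> t ^ 3 * \<rho>"
    using t2 \<rho> by (intro mult_right_mono) auto
  finally have vert1: "\<bar>vert P Q\<bar> \<le> 1"
    using \<rho>t by (simp add: mult.commute)
  define \<eta> where "\<eta> = \<bar>fst Q - fst P\<bar> + \<bar>fst (snd Q) - fst (snd P)\<bar> + (vert P Q)\<^sup>2"
  \<comment> \<open>This is where the radius \<open>1 / t ^ 3\<close> comes from: it makes the quadratic error linear in \<open>\<rho>\<close>.\<close>
  have "(vert P Q)\<^sup>2 \<le> (t\<^sup>2 * \<rho>)\<^sup>2"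
    using small_vert by (rule abs_le_square_iff[THEN iffD1, OF order_trans]) simp
  also have "\<dots> = t * \<rho> * (\<rho> * t ^ 3)"
    by (simp add: power2_eq_square power3_eq_cube)
  also have "\<dots> \<le> t * \<rho> * 1"
    using \<rho> \<rho>t t by (intro mult_left_mono) auto
  finally have "(vert P Q)\<^sup>2 \<le> t * \<rho>"
    by simp
  moreover have "\<bar>t * dx\<bar> \<le> t * \<rho>" "\<bar>t * dy\<bar> \<le> t * \<rho>"
    using \<rho> t by (simp_all add: abs_mult)
  ultimately have \<eta>: "\<eta> \<le> 3 * (t * \<rho>)"
    by (simp add: \<eta>_def PQ)
  note inc = coil_increment[OF vert1, folded \<eta>_def]
  have "t * \<rho> \<le> t\<^sup>2 * \<rho>"
    using t2 \<rho> by (intro mult_right_mono) auto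
  then have "300 * (\<bar>vert P Q\<bar> + \<eta>) \<le> 1200 * t\<^sup>2 * \<rho>"
    using \<eta> small_vert by simp
  then have horizontal: "\<bar>fst (coil Q) - fst (coil P)\<bar> \<le> 1200 * t\<^sup>2 * \<rho>"
    "\<bar>fst (snd (coil Q)) - fst (snd (coil P))\<bar> \<le> 1200 * t\<^sup>2 * \<rho>"
    using inc by linarith+
  have vertical: "\<bar>vert (coil P) (coil Q)\<bar> \<le> 900 * (t * \<rho>)"
    using inc \<eta> by linarith
  have "t * \<bar>fst (coil Q) - fst (coil P)\<bar> \<le> t * (1200 * t\<^sup>2 * \<rho>)"
    "t * \<bar>fst (snd (coil Q)) - fst (snd (coil P))\<bar> \<le> t * (1200 * t\<^sup>2 * \<rho>)"
    "t\<^sup>2 * \<bar>vert (coil P) (coil Q)\<bar> \<le> t\<^sup>2 * (1200 * (t * \<rho>))"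
    using horizontal vertical t \<rho> by (intro mult_left_mono; force intro: order_trans)+
  then show ?thesis
    using t unfolding riemannian_gauge_def stretch_def P_def[symmetric] Q_def[symmetric]
      fst_dil fst_snd_dil vert_dil right_diff_distrib[symmetric] abs_mult
    by (simp add: \<rho>_def[symmetric, unfolded riemannian_gauge_def] power2_eq_square power3_eq_cube algebra_simps)
qed

lemma convergent_of_geometric_bound:
  fixes u :: "nat \<Rightarrow> real"
  assumes le: "\<And>k n. \<bar>u (k + n) - u k\<bar> \<le> C * r ^ k" and r: "0 \<le> r" "r < 1"
  shows "convergent u"
proof -
  have "Cauchy u"
  proof (rule metric_CauchyI)
    fix e :: real assume "0 < e"
    have "(\<lambda>k. C * r ^ k) \<longlonglongrightarrow> C * 0"
      using r by (intro tendsto_mult_left LIMSEQ_realpow_zero) auto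
    then have "eventually (\<lambda>k. C * r ^ k < e / 2) sequentially"
      using \<open>0 < e\<close> by (intro order_tendstoD(2)) auto
    then obtain K where K: "C * r ^ K < e / 2"
      by (auto simp: eventually_sequentially)
    have near: "\<bar>u m - u K\<bar> < e / 2" if "m \<ge> K" for m
      using le[of K "m - K"] K that by simp
    have "dist (u m) (u n) < e" if "m \<ge> K" "n \<ge> K" for m n
      using near[OF that(1)] near[OF that(2)] unfolding dist_real_def by linarith
    then show "\<exists>M. \<forall>m\<ge>M. \<forall>n\<ge>M. dist (u m) (u n) < e"
      by blast
  qed
  then show ?thesis
    by (simp add: Cauchy_convergent_iff)
qed

lemma power_powr_swap:
  fixes x :: real
  assumes "0 < x"
  shows "(x ^ n) powr a = (x powr a) ^ n"
proof -
  have "(x ^ n) powr a = (x powr real n) powr a"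
    using assms by (simp only: powr_realpow)
  also have "\<dots> = (x powr a) powr real n"
    by (simp only: powr_powr mult.commute)
  also have "\<dots> = (x powr a) ^ n"
    using assms by (intro powr_realpow) simp
  finally show ?thesis .
qed

text \<open>
  The limit of \<open>dil (1 / s ^ k) \<circ> \<Phi> ^^ k\<close>. Consecutive maps differ by at most a multiple of \<open>1 / s ^ k\<close>. Points at
  Riemannian distance about \<open>1 / L ^ k\<close> are taken by \<open>\<Phi> ^^ k\<close> to points at bounded distance, hence by the
  limit to points at distance about \<open>1 / s ^ k\<close>. This gives the exponent \<open>ln s / ln L\<close>.
\<close>

lemma rescaled_iterates_limit:
  assumes s: "2 \<le> s" and near: "\<And>p. carnot_gauge (\<Phi> p) (dil s p) \<le> B"
    and \<delta>: "0 < \<delta>" "\<delta> \<le> 1" and L: "1 < L"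
    and lip: "\<And>p q. riemannian_gauge p q \<le> \<delta> \<Longrightarrow>
                riemannian_gauge (\<Phi> p) (\<Phi> q) \<le> L * riemannian_gauge p q"
    and \<alpha>: "0 < \<alpha>" "L powr \<alpha> \<le> s"
  obtains F M where "\<And>p. carnot_gauge (F p) p \<le> B"
    and "\<And>p q. riemannian_gauge p q \<le> \<delta> \<Longrightarrow> carnot_gauge (F p) (F q) \<le> M * riemannian_gauge p q powr \<alpha>"
proof -
  define r where "r = 1 / s"
  have r: "0 < r" "r < 1" "r * s = 1" "2 * r \<le> 1"
    using s by (auto simp: r_def)
  have B: "0 \<le> B"
    using near carnot_gauge_nonneg order_trans by blast
  define f where "f k p = dil (r ^ k) ((\<Phi> ^^ k) p)" for k p
  have f_0: "f 0 p = p" for p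
    by (simp add: f_def)
  have step: "carnot_gauge (f (Suc k) p) (f k p) \<le> B * r ^ Suc k" for k p
  proof -
    have "r ^ Suc k * s = r ^ k"
      using r by simp
    then have "f k p = dil (r ^ Suc k) (dil s ((\<Phi> ^^ k) p))"
      by (simp only: f_def dil_dil)
    then have "carnot_gauge (f (Suc k) p) (f k p)
        = r ^ Suc k * carnot_gauge (\<Phi> ((\<Phi> ^^ k) p)) (dil s ((\<Phi> ^^ k) p))"
      using carnot_gauge_dil[of "r ^ Suc k" "\<Phi> ((\<Phi> ^^ k) p)" "dil s ((\<Phi> ^^ k) p)"] r
      by (simp only: f_def funpow.simps o_def zero_le_power less_imp_le)
    also have "\<dots> \<le> r ^ Suc k * B"
      using near r by (intro mult_left_mono) auto
    finally show ?thesis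
      by (simp add: mult.commute)
  qed
  \<comment> \<open>The telescoping form of the geometric series bound lets the induction on \<open>n\<close> close.\<close>
  have tail_diff: "carnot_gauge (f (k + n) p) (f k p) \<le> B * (r ^ k - r ^ (k + n))" for k n p
  proof (induction n)
    case 0
    show ?case
      by (simp add: carnot_gauge_def vert_def)
  next
    case (Suc n)
    have "carnot_gauge (f (k + Suc n) p) (f k p)
        \<le> carnot_gauge (f (Suc (k + n)) p) (f (k + n) p) + carnot_gauge (f (k + n) p) (f k p)"
      using carnot_gauge_triangle by simp
    also have "\<dots> \<le> B * r ^ Suc (k + n) + B * (r ^ k - r ^ (k + n))"
      using step Suc.IH by (rule add_mono)
    also have "B * r ^ Suc (k + n) \<le> B * (r ^ (k + n) - r ^ Suc (k + n))"
    proof (rule mult_left_mono[OF _ B])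
      have "2 * r * r ^ (k + n) \<le> 1 * r ^ (k + n)"
        using r by (intro mult_right_mono) auto
      then show "r ^ Suc (k + n) \<le> r ^ (k + n) - r ^ Suc (k + n)"
        by simp
    qed
    finally show ?case
      by (simp add: algebra_simps)
  qed
  have tail: "carnot_gauge (f (k + n) p) (f k p) \<le> B * r ^ k" for k n p
  proof -
    have "B * (r ^ k - r ^ (k + n)) \<le> B * r ^ k"
      using B r by (intro mult_left_mono) auto
    then show ?thesis
      using tail_diff order_trans by blast
  qed
  have "\<exists>P. (\<lambda>k. f k p) \<longlonglongrightarrow> P" for p
  proof -
    have x: "\<bar>fst (f (k + n) p) - fst (f k p)\<bar> \<le> B * r ^ k" for k n
      using carnot_gaugeD(1)[of "f k p" "f (k + n) p"] tail[of k n p] by linarith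
    have y: "\<bar>fst (snd (f (k + n) p)) - fst (snd (f k p))\<bar> \<le> B * r ^ k" for k n
      using carnot_gaugeD(2)[of "f k p" "f (k + n) p"] tail[of k n p] by linarith
    \<comment> \<open>The gauge controls \<open>z\<close> only up to \<open>x\<close> times the increment of \<open>y\<close>; \<open>x\<close> stays bounded along the
      sequence.\<close>
    have z: "\<bar>snd (snd (f (k + n) p)) - snd (snd (f k p))\<bar> \<le> (B\<^sup>2 + (\<bar>fst p\<bar> + B) * B) * r ^ k" for k n
    proof -
      have "\<bar>fst (f (k + n) p)\<bar> \<le> \<bar>fst p\<bar> + B"
        using x[of 0 "k + n"] by (simp add: f_0)
      then have "\<bar>fst (f (k + n) p) * (fst (snd (f k p)) - fst (snd (f (k + n) p)))\<bar> \<le> (\<bar>fst p\<bar> + B) * (B * r ^ k)"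
        unfolding abs_mult using y[of k n] by (intro mult_mono) (auto simp: abs_minus_commute B)
      moreover have "\<bar>vert (f (k + n) p) (f k p)\<bar> \<le> B\<^sup>2 * r ^ k"
      proof -
        have "\<bar>vert (f (k + n) p) (f k p)\<bar> \<le> (B * r ^ k)\<^sup>2"
          using carnot_gauge_le_iff tail r B by (metis mult_nonneg_nonneg less_imp_le zero_le_power)
        also have "\<dots> \<le> B\<^sup>2 * r ^ k"
        proof -
          have "r ^ k * r ^ k \<le> r ^ k"
            using r by (intro mult_left_le power_le_one) auto
          then show ?thesis
            by (simp add: power_mult_distrib mult_left_mono power2_eq_square[of "r ^ k"])
        qed
        finally show ?thesis .
      qed
      ultimately show ?thesis
        by (simp add: vert_def algebra_simps)
    qed
    have "convergent (\<lambda>k. fst (f k p))" "convergent (\<lambda>k. fst (snd (f k p)))" "convergent (\<lambda>k. snd (snd (f k p)))"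
      by (rule convergent_of_geometric_bound[OF _ less_imp_le[OF r(1)] r(2)], rule x y z)+
    then obtain a b c where "(\<lambda>k. fst (f k p)) \<longlonglongrightarrow> a" "(\<lambda>k. fst (snd (f k p))) \<longlonglongrightarrow> b"
        "(\<lambda>k. snd (snd (f k p))) \<longlonglongrightarrow> c"
      unfolding convergent_def by blast
    then have "(\<lambda>k. (fst (f k p), fst (snd (f k p)), snd (snd (f k p)))) \<longlonglongrightarrow> (a, b, c)"
      by (intro tendsto_Pair)
    then show ?thesis
      by auto
  qed
  then obtain F where F: "\<And>p. (\<lambda>k. f k p) \<longlonglongrightarrow> F p"
    by metis
  have limit: "carnot_gauge (F p) (f k p) \<le> B * r ^ k" for k p
  proof (rule LIMSEQ_le_const2)
    have "(\<lambda>n. f (k + n) p) \<longlonglongrightarrow> F p"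
      using LIMSEQ_ignore_initial_segment[OF F[of p], of k] by (simp add: add.commute)
    then show "(\<lambda>n. carnot_gauge (f (k + n) p) (f k p)) \<longlonglongrightarrow> carnot_gauge (F p) (f k p)"
      unfolding carnot_gauge_def vert_def by (intro tendsto_intros)
  qed (use tail in blast)
  define M where "M = (3 * B + 1) * s / \<delta> powr \<alpha>"
  have "carnot_gauge (F p) (F q) \<le> M * riemannian_gauge p q powr \<alpha>" if small: "riemannian_gauge p q \<le> \<delta>" for p q
  proof (cases "riemannian_gauge p q = 0")
    case True
    then have "p = q"
      by (cases p, cases q) (auto simp: riemannian_gauge_def vert_def max_def split: if_splits)
    then show ?thesis
      using True by (simp add: carnot_gauge_def vert_def)
  next
    case False
    define \<rho> where "\<rho> = riemannian_gauge p q"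
    have \<rho>: "0 < \<rho>" "\<rho> \<le> \<delta>"
      using False small riemannian_gauge_nonneg[of p q] by (simp_all add: \<rho>_def)
    \<comment> \<open>Choose \<open>k\<close> as the last step at which the iterates of \<open>p\<close> and \<open>q\<close> are guaranteed to be
      \<open>\<delta>\<close>-close, so that \<open>f k p\<close> and \<open>f k q\<close> are at distance at most \<open>r ^ k\<close>.\<close>
    obtain n where "\<delta> / \<rho> < L ^ n"
      using real_arch_pow[OF L] by blast
    then have "\<delta> < L ^ n * \<rho>"
      using \<rho> by (simp add: field_simps)
    moreover have "\<not> \<delta> < L ^ 0 * \<rho>"
      using \<rho> by simp
    ultimately obtain k where k: "\<forall>i\<le>k. \<not> \<delta> < L ^ i * \<rho>" "\<delta> < L ^ Suc k * \<rho>"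
      using ex_least_nat_less[of "\<lambda>n. \<delta> < L ^ n * \<rho>" n] by auto
    have below: "L ^ i * \<rho> \<le> \<delta>" if "i \<le> k" for i
      using k(1) that by (simp add: not_less)
    have "riemannian_gauge ((\<Phi> ^^ i) p) ((\<Phi> ^^ i) q) \<le> L ^ i * \<rho>" if "i \<le> k" for i
      using that
    proof (induction i)
      case (Suc i)
      then have IH: "riemannian_gauge ((\<Phi> ^^ i) p) ((\<Phi> ^^ i) q) \<le> L ^ i * \<rho>"
        by simp
      also have "\<dots> \<le> \<delta>"
        using below Suc.prems by simp
      finally have "riemannian_gauge ((\<Phi> ^^ Suc i) p) ((\<Phi> ^^ Suc i) q)
          \<le> L * riemannian_gauge ((\<Phi> ^^ i) p) ((\<Phi> ^^ i) q)"
        using lip by simp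
      also have "\<dots> \<le> L * (L ^ i * \<rho>)"
        using IH L by (intro mult_left_mono) auto
      finally show ?case
        by simp
    qed (simp add: \<rho>_def)
    then have "riemannian_gauge ((\<Phi> ^^ k) p) ((\<Phi> ^^ k) q) \<le> 1"
      using below[of k] \<delta>(2) by (meson order_refl order_trans)
    then have "carnot_gauge (f k p) (f k q) \<le> r ^ k * 1"
      unfolding f_def using r by (subst carnot_gauge_dil) (auto intro!: carnot_gauge_le_1 mult_left_le)
    moreover have "carnot_gauge (f k q) (F q) \<le> 2 * (B * r ^ k)"
      using carnot_gauge_sym[of "f k q" "F q"] limit[of q k] by linarith
    ultimately have "carnot_gauge (F p) (F q) \<le> (3 * B + 1) * r ^ k"
      using carnot_gauge_triangle[of "F p" "F q" "f k p"] carnot_gauge_triangle[of "f k p" "F q" "f k q"]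
        limit[of p k] by (simp add: algebra_simps)
    also have "\<dots> \<le> (3 * B + 1) * (s * (\<rho> / \<delta>) powr \<alpha>)"
    proof (rule mult_left_mono)
      have inverse: "(\<delta> / \<rho>) powr \<alpha> * (\<rho> / \<delta>) powr \<alpha> = 1"
        using \<rho> \<delta> by (simp flip: powr_mult)
      have "(\<delta> / \<rho>) powr \<alpha> \<le> (L ^ Suc k) powr \<alpha>"
        using k(2) \<rho> \<delta> \<alpha> by (intro powr_mono2) (auto simp: field_simps)
      also have "\<dots> = (L powr \<alpha>) ^ Suc k"
        using L by (intro power_powr_swap) auto
      also have "\<dots> \<le> s ^ Suc k"
        using \<alpha> by (intro power_mono) auto
      finally have le: "(\<delta> / \<rho>) powr \<alpha> \<le> s ^ Suc k" .
      have "r ^ k = (\<delta> / \<rho>) powr \<alpha> * ((\<rho> / \<delta>) powr \<alpha> * r ^ k)"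
        using inverse by (simp only: mult.assoc[symmetric] mult_1_left)
      also have "\<dots> \<le> s ^ Suc k * ((\<rho> / \<delta>) powr \<alpha> * r ^ k)"
        using le r by (intro mult_right_mono) auto
      also have "\<dots> = s * (r * s) ^ k * (\<rho> / \<delta>) powr \<alpha>"
        by (simp only: power_mult_distrib power_Suc mult_ac)
      finally show "r ^ k \<le> s * (\<rho> / \<delta>) powr \<alpha>"
        using r by simp
    qed (use B in simp)
    also have "\<dots> = M * \<rho> powr \<alpha>"
      using \<rho> \<delta> by (simp add: M_def powr_divide)
    finally show ?thesis
      by (simp add: \<rho>_def)
  qed
  moreover have "carnot_gauge (F p) p \<le> B" for p
    using limit[of p 0] by (simp add: f_0)
  ultimately show ?thesis
    by (rule that[rotated])
qed

text \<open>
  With \<open>s = t\<^sup>2\<close> and \<open>L = 1200 * t ^ 3\<close> the exponent \<open>ln s / ln L\<close> tends to \<open>2 / 3\<close> as \<open>t\<close> grows, because the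
  constant 1200 is the same for all \<open>t\<close>.
\<close>

proposition Hoelder_perturbation_of_identity:
  assumes \<alpha>: "0 < \<alpha>" "\<alpha> < 2 / 3"
  obtains F B M \<delta> where "\<And>p. carnot_gauge (F p) p \<le> B" and "0 < \<delta>"
    and "\<And>p q. riemannian_gauge p q \<le> \<delta> \<Longrightarrow> carnot_gauge (F p) (F q) \<le> M * riemannian_gauge p q powr \<alpha>"
proof -
  \<comment> \<open>Large enough that \<open>(1200 * t ^ 3) powr \<alpha> \<le> t\<^sup>2\<close>; the exponent \<open>2 - 3 * \<alpha>\<close> is positive.\<close>
  define t where "t = max 2 (1200 powr (\<alpha> / (2 - 3 * \<alpha>)))"
  have t: "2 \<le> t" "1200 powr (\<alpha> / (2 - 3 * \<alpha>)) \<le> t"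
    by (simp_all add: t_def)
  have "1200 powr \<alpha> = (1200 powr (\<alpha> / (2 - 3 * \<alpha>))) powr (2 - 3 * \<alpha>)"
    using \<alpha> by (simp add: powr_powr)
  also have "\<dots> \<le> t powr (2 - 3 * \<alpha>)"
    using t \<alpha> by (intro powr_mono2) auto
  finally have "(1200 * t ^ 3) powr \<alpha> \<le> t powr (2 - 3 * \<alpha>) * (t ^ 3) powr \<alpha>"
    using t by (simp add: powr_mult mult_right_mono)
  also have "(t ^ 3) powr \<alpha> = t powr (3 * \<alpha>)"
  proof -
    have "t ^ 3 = t powr 3"
      using t by simp
    then show ?thesis
      by (simp only: powr_powr)
  qed
  also have "t powr (2 - 3 * \<alpha>) * t powr (3 * \<alpha>) = t\<^sup>2"
    using t by (simp flip: powr_add)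
  finally have exponent: "(1200 * t ^ 3) powr \<alpha> \<le> t\<^sup>2" .
  have t3: "1 \<le> t ^ 3" and "2 \<le> t\<^sup>2"
    using t power_mono[of 2 t 2] by auto
  then have *: "2 \<le> t\<^sup>2" "0 < 1 / t ^ 3" "1 / t ^ 3 \<le> 1" "1 < 1200 * t ^ 3"
    using t t3 by (simp_all, linarith)
  have near: "carnot_gauge (stretch t p) (dil (t\<^sup>2) p) \<le> 5 * t" for p
    using t by (intro carnot_gauge_stretch) auto
  have lip: "riemannian_gauge (stretch t p) (stretch t q) \<le> 1200 * t ^ 3 * riemannian_gauge p q"
    if "riemannian_gauge p q \<le> 1 / t ^ 3" for p q
    using t that by (intro riemannian_gauge_stretch) auto
  from rescaled_iterates_limit[OF *(1) near *(2,3,4) lip \<alpha>(1) exponent] *(2) show ?thesis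
    by (metis that)
qed


section \<open>Approximation on compact metric spaces\<close>

lemma riemannian_gauge_le_of_Lipschitz_coordinates:
  fixes f :: "'a::metric_space \<Rightarrow> heis"
  assumes x: "C-lipschitz_on Y (\<lambda>y. fst (f y))"
    and y: "C-lipschitz_on Y (\<lambda>y. fst (snd (f y)))"
    and z: "C-lipschitz_on Y (\<lambda>y. snd (snd (f y)))"
    and bound: "\<And>y. y \<in> Y \<Longrightarrow> \<bar>fst (f y)\<bar> \<le> R"
    and Y: "u \<in> Y" "v \<in> Y"
  shows "riemannian_gauge (f u) (f v) \<le> (1 + \<bar>R\<bar>) * C * dist u v"
proof -
  have C: "0 \<le> C"
    using x by (rule lipschitz_on_nonneg)
  have d: "\<bar>fst (f v) - fst (f u)\<bar> \<le> C * dist u v" "\<bar>fst (snd (f v)) - fst (snd (f u))\<bar> \<le> C * dist u v"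
    "\<bar>snd (snd (f v)) - snd (snd (f u))\<bar> \<le> C * dist u v"
    using lipschitz_onD[OF x Y(2,1)] lipschitz_onD[OF y Y(2,1)] lipschitz_onD[OF z Y(2,1)]
    by (simp_all add: dist_real_def dist_commute)
  have le: "C * dist u v \<le> (1 + \<bar>R\<bar>) * C * dist u v"
    using C by (simp add: distrib_right)
  have "\<bar>fst (f u) * (fst (snd (f v)) - fst (snd (f u)))\<bar> \<le> \<bar>R\<bar> * (C * dist u v)"
    unfolding abs_mult using bound[OF Y(1)] d(2) by (intro mult_mono) auto
  then have "\<bar>vert (f u) (f v)\<bar> \<le> C * dist u v + \<bar>R\<bar> * (C * dist u v)"
    using d(3) unfolding vert_def by linarith
  also have "\<dots> = (1 + \<bar>R\<bar>) * C * dist u v"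
    by (simp add: algebra_simps)
  finally show ?thesis
    using d(1,2) le by (auto simp: riemannian_gauge_def)
qed

text \<open>
  Lipschitz functions on a compact metric space form an algebra that contains the distance functions,
  so the Stone-Weierstrass theorem applies.
\<close>

lemma Lipschitz_approximation:
  fixes f :: "'a::metric_space \<Rightarrow> real"
  assumes Y: "compact Y" and f: "continuous_on Y f" and e: "0 < e"
  obtains h C where "C-lipschitz_on Y h" and "\<And>y. y \<in> Y \<Longrightarrow> \<bar>f y - h y\<bar> < e"
proof -
  define R where "R = {h. \<exists>C. C-lipschitz_on Y (h :: 'a \<Rightarrow> real)}"
  interpret function_ring_on R Y
  proof
    show "compact Y"
      by fact
    show "continuous_on Y h" if "h \<in> R" for h
      using that lipschitz_on_continuous_on by (auto simp: R_def)
    show "(\<lambda>x. h x + k x) \<in> R" if "h \<in> R" "k \<in> R" for h k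
      using that lipschitz_on_add by (fastforce simp: R_def)
    show "(\<lambda>x. h x * k x) \<in> R" if hk: "h \<in> R" "k \<in> R" for h k
    proof -
      from hk obtain C D where C: "C-lipschitz_on Y h" and D: "D-lipschitz_on Y k"
        by (auto simp: R_def)
      have "bounded (h ` Y)" "bounded (k ` Y)"
        using C D Y by (auto intro!: compact_imp_bounded compact_continuous_image lipschitz_on_continuous_on)
      then obtain A B where A: "\<And>y. y \<in> Y \<Longrightarrow> \<bar>h y\<bar> \<le> A" and B: "\<And>y. y \<in> Y \<Longrightarrow> \<bar>k y\<bar> \<le> B"
        unfolding bounded_iff by auto
      have "(\<bar>A\<bar> * D + \<bar>B\<bar> * C)-lipschitz_on Y (\<lambda>x. h x * k x)"
      proof (rule lipschitz_onI)
        fix u v assume uv: "u \<in> Y" "v \<in> Y"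
        have "h u * k u - h v * k v = h u * (k u - k v) + k v * (h u - h v)"
          by (simp add: algebra_simps)
        then have "\<bar>h u * k u - h v * k v\<bar> \<le> \<bar>h u\<bar> * \<bar>k u - k v\<bar> + \<bar>k v\<bar> * \<bar>h u - h v\<bar>"
          using abs_triangle_ineq by (simp flip: abs_mult)
        also have "\<dots> \<le> \<bar>A\<bar> * (D * dist u v) + \<bar>B\<bar> * (C * dist u v)"
          using A[OF uv(1)] B[OF uv(2)] lipschitz_onD[OF C uv] lipschitz_onD[OF D uv]
          by (intro add_mono mult_mono) (auto simp: dist_real_def)
        finally show "dist (h u * k u) (h v * k v) \<le> (\<bar>A\<bar> * D + \<bar>B\<bar> * C) * dist u v"
          by (simp add: dist_real_def algebra_simps)
      qed (use C D in \<open>simp add: lipschitz_on_nonneg\<close>)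
      then show ?thesis
        by (auto simp: R_def)
    qed
    show "(\<lambda>_. c) \<in> R" for c
      unfolding R_def using lipschitz_on_constant by blast
    show "\<exists>h\<in>R. h u \<noteq> h v" if "u \<in> Y" "v \<in> Y" "u \<noteq> v" for u v
    proof (rule bexI)
      show "dist u u \<noteq> dist u v"
        using that by simp
      have "1-lipschitz_on Y (dist u)"
        using abs_dist_diff_le[of _ u] by (intro lipschitz_onI) (auto simp: dist_real_def dist_commute)
      then show "dist u \<in> R"
        by (auto simp: R_def)
    qed
  qed
  from Stone_Weierstrass_basic[OF f e] that show ?thesis
    by (auto simp: R_def)
qed

lemma carnot_gauge_small_of_close_coordinates:
  assumes p: "\<bar>fst p\<bar> \<le> R" and e: "0 < e" "e \<le> 1"
    and close: "\<bar>fst p - fst q\<bar> < e\<^sup>2 / (2 + R)" "\<bar>fst (snd p) - fst (snd q)\<bar> < e\<^sup>2 / (2 + R)"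
      "\<bar>snd (snd p) - snd (snd q)\<bar> < e\<^sup>2 / (2 + R)"
  shows "carnot_gauge p q \<le> e"
proof -
  define d where "d = e\<^sup>2 / (2 + R)"
  have R: "0 \<le> R"
    using p by linarith
  have "d * (1 + R) \<le> d * (2 + R)"
    using R e by (intro mult_left_mono) (auto simp: d_def)
  also have "\<dots> = e\<^sup>2"
    using R by (simp add: d_def)
  finally have d: "d * (1 + R) \<le> e\<^sup>2" .
  have d0: "0 \<le> d"
    using R by (simp add: d_def)
  then have "d \<le> d * (1 + R)"
    using R by (simp add: algebra_simps)
  also have "d * (1 + R) \<le> e * e"
    using d by (simp add: power2_eq_square)
  also have "e * e \<le> e * 1"
    using e by (intro mult_left_mono) auto
  finally have "d \<le> e"
    by simp
  have "\<bar>fst p * (fst (snd q) - fst (snd p))\<bar> \<le> R * d"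
    unfolding abs_mult using p close(2) R by (intro mult_mono) (auto simp: d_def abs_minus_commute)
  then have "\<bar>vert p q\<bar> \<le> d + R * d"
    using close(3) unfolding vert_def d_def[symmetric] by linarith
  also have "\<dots> \<le> e\<^sup>2"
    using d by (simp add: algebra_simps)
  finally show ?thesis
    using close \<open>d \<le> e\<close> e by (subst carnot_gauge_le_iff) (auto simp: d_def abs_minus_commute)
qed

text \<open>
  First approximate the coordinates by Lipschitz functions, then compose with \<open>dil s \<circ> F \<circ> dil (1 / s)\<close> for
  the map \<open>F\<close> constructed above and small \<open>s\<close>.
\<close>

proposition continuous_imp_Hoelder_approximation:
  fixes \<phi> :: "'a::metric_space \<Rightarrow> heis"
  assumes Y: "compact Y" and \<alpha>: "0 < \<alpha>" "\<alpha> < 2 / 3" and \<phi>: "continuous_on Y \<phi>" and e: "0 < e"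
  obtains \<psi> L where "0 < L" and "\<And>u v. u \<in> Y \<Longrightarrow> v \<in> Y \<Longrightarrow> carnot_gauge (\<psi> u) (\<psi> v) \<le> L * dist u v powr \<alpha>"
    and "\<And>y. y \<in> Y \<Longrightarrow> carnot_gauge (\<phi> y) (\<psi> y) \<le> e"
proof -
  have "bounded ((\<lambda>y. fst (\<phi> y)) ` Y)"
    using Y \<phi> by (intro compact_imp_bounded compact_continuous_image continuous_on_fst)
  then obtain R where R: "\<And>y. y \<in> Y \<Longrightarrow> \<bar>fst (\<phi> y)\<bar> \<le> R" and R0: "0 < R"
    unfolding bounded_pos by auto
  define e' where "e' = min 1 (e / 2)"
  have e': "0 < e'" "e' \<le> 1" "e' \<le> e / 2"
    using e by (auto simp: e'_def)
  define d where "d = e'\<^sup>2 / (2 + R)"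
  have d: "0 < d"
    using e' R0 by (simp add: d_def)
  obtain h1 C1 where h1: "C1-lipschitz_on Y h1" "\<And>y. y \<in> Y \<Longrightarrow> \<bar>fst (\<phi> y) - h1 y\<bar> < d"
    using Lipschitz_approximation[OF Y continuous_on_fst[OF \<phi>] d] by blast
  obtain h2 C2 where h2: "C2-lipschitz_on Y h2" "\<And>y. y \<in> Y \<Longrightarrow> \<bar>fst (snd (\<phi> y)) - h2 y\<bar> < d"
    using Lipschitz_approximation[OF Y continuous_on_fst[OF continuous_on_snd[OF \<phi>]] d] by blast
  obtain h3 C3 where h3: "C3-lipschitz_on Y h3" "\<And>y. y \<in> Y \<Longrightarrow> \<bar>snd (snd (\<phi> y)) - h3 y\<bar> < d"
    using Lipschitz_approximation[OF Y continuous_on_snd[OF continuous_on_snd[OF \<phi>]] d] by blast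
  define \<phi>' where "\<phi>' y = (h1 y, h2 y, h3 y)" for y
  have \<phi>': "carnot_gauge (\<phi> y) (\<phi>' y) \<le> e / 2" if "y \<in> Y" for y
  proof -
    have "carnot_gauge (\<phi> y) (\<phi>' y) \<le> e'"
      using R[OF that] e'(1,2) h1(2)[OF that] h2(2)[OF that] h3(2)[OF that]
      by (intro carnot_gauge_small_of_close_coordinates) (simp_all add: \<phi>'_def d_def)
    then show ?thesis
      using e'(3) by linarith
  qed
  obtain F B M \<delta> where F: "\<And>p. carnot_gauge (F p) p \<le> B" and \<delta>: "0 < \<delta>"
    and F_Hoelder: "\<And>p q. riemannian_gauge p q \<le> \<delta> \<Longrightarrow> carnot_gauge (F p) (F q) \<le> M * riemannian_gauge p q powr \<alpha>"
    using Hoelder_perturbation_of_identity[OF \<alpha>] by metis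
  have B0: "0 \<le> B"
    using F carnot_gauge_nonneg order_trans by blast
  \<comment> \<open>Conjugating \<open>F\<close> by the dilation \<open>dil s\<close> shrinks its distance from the identity from \<open>B\<close> to \<open>s * B\<close>.\<close>
  define s where "s = e / (4 * B + 4)"
  have s: "0 < s" "2 * (s * B) \<le> e / 2"
    using e B0 by (auto simp: s_def field_simps)
  define \<psi> where "\<psi> y = dil s (F (dil (1 / s) (\<phi>' y)))" for y
  have close: "carnot_gauge (\<phi> y) (\<psi> y) \<le> e" if "y \<in> Y" for y
  proof -
    have "carnot_gauge (\<psi> y) (dil s (dil (1 / s) (\<phi>' y))) = s * carnot_gauge (F (dil (1 / s) (\<phi>' y))) (dil (1 / s) (\<phi>' y))"
      unfolding \<psi>_def using s by (intro carnot_gauge_dil) auto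
    also have "\<dots> \<le> s * B"
      using s F by (intro mult_left_mono) auto
    finally have "carnot_gauge (\<psi> y) (\<phi>' y) \<le> s * B"
      using s by simp
    then show ?thesis
      using carnot_gauge_triangle[of "\<phi> y" "\<psi> y" "\<phi>' y"] carnot_gauge_sym[of "\<phi>' y" "\<psi> y"] \<phi>'[OF that] s(2)
      by linarith
  qed
  define C where "C = C1 + C2 + C3"
  have C123: "0 \<le> C1" "0 \<le> C2" "0 \<le> C3"
    using h1 h2 h3 by (auto intro: lipschitz_on_nonneg)
  define g where "g y = dil (1 / s) (\<phi>' y)" for y
  have lip_scale: "(\<bar>c\<bar> * C)-lipschitz_on Y (\<lambda>y. c * h y)" if "D-lipschitz_on Y h" "D \<le> C" for h :: "'a \<Rightarrow> real" and c D
    using lipschitz_on_cmult_real[OF lipschitz_on_mono[OF that(1) order_refl that(2)], of c] by simp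
  define K where "K = max 1 (max (\<bar>1 / s\<bar> * C) (\<bar>(1 / s)\<^sup>2\<bar> * C))"
  have "K-lipschitz_on Y (\<lambda>y. fst (g y))" "K-lipschitz_on Y (\<lambda>y. fst (snd (g y)))" "K-lipschitz_on Y (\<lambda>y. snd (snd (g y)))"
    using lip_scale[OF h1(1), of "1 / s"] lip_scale[OF h2(1), of "1 / s"] lip_scale[OF h3(1), of "(1 / s)\<^sup>2"] C123
    unfolding g_def dil_def \<phi>'_def C_def K_def by (auto elim!: lipschitz_on_mono simp del: power_divide)
  note g_lip = this
  have "bounded ((\<lambda>y. fst (g y)) ` Y)"
    using Y g_lip(1) by (intro compact_imp_bounded compact_continuous_image lipschitz_on_continuous_on)
  then obtain A where A: "\<And>y. y \<in> Y \<Longrightarrow> \<bar>fst (g y)\<bar> \<le> A"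
    unfolding bounded_iff by auto
  define N where "N = (1 + \<bar>A\<bar>) * K"
  have N: "1 \<le> N"
    using mult_mono[of 1 "1 + \<bar>A\<bar>" 1 K] by (simp add: N_def K_def)
  have g_gauge: "riemannian_gauge (g u) (g v) \<le> N * dist u v" if "u \<in> Y" "v \<in> Y" for u v
    unfolding N_def using g_lip A that by (rule riemannian_gauge_le_of_Lipschitz_coordinates)
  have \<psi>_scale: "carnot_gauge (\<psi> u) (\<psi> v) = s * carnot_gauge (F (g u)) (F (g v))" for u v
    unfolding \<psi>_def g_def using s by (intro carnot_gauge_dil) auto
  obtain D where D: "\<And>u v. u \<in> Y \<Longrightarrow> v \<in> Y \<Longrightarrow> dist u v \<le> D"
    using compact_imp_bounded[OF Y] unfolding bounded_two_points by metis
  \<comment> \<open>A crude bound on the diameter of the image takes care of pairs that are not close.\<close>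
  define E where "E = s * (B + (1 + N * \<bar>D\<bar>) + 2 * B)"
  have E0: "0 \<le> E"
    using s B0 N by (auto simp: E_def)
  have E: "carnot_gauge (\<psi> u) (\<psi> v) \<le> E" if uv: "u \<in> Y" "v \<in> Y" for u v
  proof -
    have "N * dist u v \<le> N * \<bar>D\<bar>"
      using D[OF uv] N by (intro mult_left_mono) auto
    then have "carnot_gauge (g u) (g v) \<le> 1 + N * \<bar>D\<bar>"
      using carnot_gauge_le_riemannian_gauge[of "g u" "g v"] g_gauge[OF uv] by linarith
    then have "carnot_gauge (F (g u)) (F (g v)) \<le> B + (1 + N * \<bar>D\<bar>) + 2 * B"
      using carnot_gauge_triangle[of "F (g u)" "F (g v)" "g u"]
        carnot_gauge_triangle[of "g u" "F (g v)" "g v"] carnot_gauge_sym[of "g v" "F (g v)"]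
        F[of "g u"] F[of "g v"] by linarith
    then show ?thesis
      unfolding \<psi>_scale E_def using s by (intro mult_left_mono) auto
  qed
  define L where "L = max 1 (max (s * \<bar>M\<bar> * N powr \<alpha>) (E * (N / \<delta>) powr \<alpha>))"
  have "carnot_gauge (\<psi> u) (\<psi> v) \<le> L * dist u v powr \<alpha>" if uv: "u \<in> Y" "v \<in> Y" for u v
  proof (cases "N * dist u v \<le> \<delta>")
    case True
    have small: "riemannian_gauge (g u) (g v) \<le> N * dist u v"
      using uv by (rule g_gauge)
    have "carnot_gauge (\<psi> u) (\<psi> v) = s * carnot_gauge (F (g u)) (F (g v))"
      by (rule \<psi>_scale)
    also have "\<dots> \<le> s * (M * riemannian_gauge (g u) (g v) powr \<alpha>)"
      using s small True by (intro mult_left_mono F_Hoelder) auto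
    also have "\<dots> \<le> s * (\<bar>M\<bar> * (N * dist u v) powr \<alpha>)"
      using s small \<alpha> by (intro mult_left_mono mult_mono powr_mono2) (auto simp: riemannian_gauge_def)
    also have "\<dots> = s * \<bar>M\<bar> * N powr \<alpha> * dist u v powr \<alpha>"
      using N by (simp add: powr_mult)
    also have "\<dots> \<le> L * dist u v powr \<alpha>"
      by (intro mult_right_mono) (auto simp: L_def)
    finally show ?thesis .
  next
    case False
    have "1 \<le> (N / \<delta> * dist u v) powr \<alpha>"
      using False \<delta> \<alpha> by (intro ge_one_powr_ge_zero) (auto simp: field_simps)
    then have "E * 1 \<le> E * (N / \<delta> * dist u v) powr \<alpha>"
      using E0 by (intro mult_left_mono) auto
    also have "\<dots> = E * (N / \<delta>) powr \<alpha> * dist u v powr \<alpha>"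
      using N \<delta> powr_mult[of "N / \<delta>" "dist u v" \<alpha>] by simp
    also have "\<dots> \<le> L * dist u v powr \<alpha>"
      by (intro mult_right_mono) (auto simp: L_def)
    finally show ?thesis
      using E[OF uv] by simp
  qed
  moreover have "0 < L"
    by (simp add: L_def)
  ultimately show ?thesis
    using close that by blast
qed


theorem theorem1p3:
  fixes g :: "heis \<Rightarrow> heis \<Rightarrow> heis \<Rightarrow> real"
    and Y :: "'a::metric_space set"
    and \<alpha> :: real
    and \<phi> :: "'a \<Rightarrow> heis"
  assumes "left_invariant_riemannian g"
    and "V1_V2_orthogonal g"
    and "compact Y"
    and "0 < \<alpha>" and "\<alpha> < 2 / 3"
    and "continuous_on Y \<phi>"
  shows "\<forall>\<epsilon>::real>0. \<exists>\<psi>. holder_on \<alpha> Y (d_c g) \<psi> \<and>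
           (\<forall>y \<in> Y. d_c g (\<phi> y) (\<psi> y) \<le> ennreal \<epsilon>)"
proof (intro allI impI)
  fix \<epsilon> :: real assume \<epsilon>: "0 < \<epsilon>"
  obtain C where C: "0 < C" "\<And>p q. d_c g p q \<le> ennreal (C * carnot_gauge p q)"
    using d_c_le_carnot_gauge[OF assms(1)] by blast
  have "0 < \<epsilon> / C"
    using C \<epsilon> by simp
  then obtain \<psi> L where L: "0 < L"
    and Hoelder: "\<And>u v. u \<in> Y \<Longrightarrow> v \<in> Y \<Longrightarrow> carnot_gauge (\<psi> u) (\<psi> v) \<le> L * dist u v powr \<alpha>"
    and close: "\<And>y. y \<in> Y \<Longrightarrow> carnot_gauge (\<phi> y) (\<psi> y) \<le> \<epsilon> / C"
    using continuous_imp_Hoelder_approximation[OF assms(3-6)] by metis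
  have "d_c g (\<psi> u) (\<psi> v) \<le> ennreal (C * L * dist u v powr \<alpha>)" if "u \<in> Y" "v \<in> Y" for u v
  proof -
    note C(2)[of "\<psi> u" "\<psi> v"]
    also have "C * carnot_gauge (\<psi> u) (\<psi> v) \<le> C * (L * dist u v powr \<alpha>)"
      using Hoelder[OF that] C(1) by (intro mult_left_mono) auto
    finally show ?thesis
      by (simp add: ennreal_leI mult.assoc)
  qed
  then have "holder_on \<alpha> Y (d_c g) \<psi>"
    unfolding holder_on_def using C(1) L by (intro exI[of _ "C * L"]) simp
  moreover have "d_c g (\<phi> y) (\<psi> y) \<le> ennreal \<epsilon>" if "y \<in> Y" for y
  proof -
    note C(2)[of "\<phi> y" "\<psi> y"]
    also have "C * carnot_gauge (\<phi> y) (\<psi> y) \<le> C * (\<epsilon> / C)"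
      using close[OF that] C(1) by (intro mult_left_mono) auto
    finally show ?thesis
      using C(1) by (simp add: ennreal_leI)
  qed
  ultimately show "\<exists>\<psi>. holder_on \<alpha> Y (d_c g) \<psi> \<and> (\<forall>y \<in> Y. d_c g (\<phi> y) (\<psi> y) \<le> ennreal \<epsilon>)"
    by blast
qed

end
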